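(* Let $(M_1,\Pi_1)$ and $(M_2,\Pi_2)$ be two Poisson manifolds such that $\Pi_2$ is non trivial (i.e. $\Pi_2\neq 0$), and let $\mu$ be a smooth function on $M_1$. Let $\Pi^{\mu}=\Pi_1^h+\mu^h\Pi_2^v$ be the warped bivector field on $M_1\times M_2$. Then $(M_1\times M_2,\Pi^{\mu})$ is a Poisson manifold (i.e. $\Pi^\mu$ is a Poisson tensor) if and only if $\mu$ is a Casimir function of $(M_1,\Pi_1)$.
   Context: A bivector field $\Pi$ on a manifold $M$ is a Poisson tensor if $[\Pi,\Pi]_S=0$ for the Schouten–Nijenhuis bracket, equivalently if $\{\varphi,\psi\}=\Pi(d\varphi,d\psi)$ satisfies the Jacobi identity on $C^\infty(M)$; then $(M,\Pi)$ is a Poisson manifold. The anchor map $\sharp_\Pi:T^*M\to TM$ is defined by $\beta(\sharp_\Pi(\alpha))=\Pi(\alpha,\beta)$. A function $\varphi$ is Casimir if its Hamiltonian vector field $X_\varphi=\sharp_\Pi(d\varphi)$ vanishes identically. Let $\sigma_i:M_1\times M_2\to M_i$ be the projections. For functions and differential forms, the horizontal lift from $M_1$ is $\omega_1^h=\sigma_1^*\omega_1$ and the vertical lift from $M_2$ is $\omega_2^v=\sigma_2^*\omega_2$. The warped bivector field $\Pi^\mu=\Pi_1^h+\mu^h\Pi_2^v$ is the unique bivector field on $M_1\times M_2$ such that for all 1-forms $\alpha_i,\beta_i$ on $M_i$: $\Pi^\mu(\alpha_1^h,\beta_1^h)=\Pi_1(\alpha_1,\beta_1)^h$, $\Pi^\mu(\alpha_2^v,\beta_2^v)=\mu^h\,\Pi_2(\alpha_2,\beta_2)^v$,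 $\Pi^\mu(\alpha_1^h,\beta_2^v)=0$. *)

theory Defs
  imports "HOL-Analysis.Analysis"
begin

section \<open>Smooth manifolds\<close>

text \<open>
  The model spaces are the finite-dimensional real vector spaces (the inner product is only a
  convenience). Unlike \<^class>\<open>euclidean_space\<close>, this class does not exclude dimension 0.
\<close>

class fin_dim_inner = real_inner +
  assumes finite_spanning_set: "\<exists>B. finite B \<and> (\<forall>x. \<exists>c. x = (\<Sum>b\<in>B. c b *\<^sub>R b))"

instance euclidean_space \<subseteq> fin_dim_inner
proof
  show "\<exists>B :: 'a set. finite B \<and> (\<forall>x. \<exists>c. x = (\<Sum>b\<in>B. c b *\<^sub>R b))"
    by (intro exI[of _ Basis] conjI allI) (auto intro: finite_Basis euclidean_representation[symmetric])
qed

instance prod :: (fin_dim_inner, fin_dim_inner) fin_dim_inner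
proof
  obtain B :: "'a set" where B: "finite B" "\<And>x. \<exists>c. x = (\<Sum>b\<in>B. c b *\<^sub>R b)"
    using finite_spanning_set by blast
  obtain C :: "'b set" where C: "finite C" "\<And>y. \<exists>d. y = (\<Sum>b\<in>C. d b *\<^sub>R b)"
    using finite_spanning_set by blast
  let ?I = "(\<lambda>b. (b, 0)) ` B" and ?J = "(\<lambda>b. (0, b)) ` (C - {0})"
  have disj: "?I \<inter> ?J = {}" by auto
  have "\<exists>k. z = (\<Sum>b\<in>?I \<union> ?J. k b *\<^sub>R b)" for z :: "'a \<times> 'b"
  proof -
    obtain c where c: "fst z = (\<Sum>b\<in>B. c b *\<^sub>R b)" using B(2) by blast
    obtain d where "snd z = (\<Sum>b\<in>C. d b *\<^sub>R b)" using C(2) by blast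
    also have "\<dots> = (\<Sum>b\<in>C - {0}. d b *\<^sub>R b)"
      using C(1) by (intro sum.mono_neutral_right) auto
    finally have d: "snd z = (\<Sum>b\<in>C - {0}. d b *\<^sub>R b)" .
    define k where "k = (\<lambda>(a, b). if b = 0 then c a else d b)"
    have "(\<Sum>b\<in>?I \<union> ?J. k b *\<^sub>R b) = (\<Sum>b\<in>?I. k b *\<^sub>R b) + (\<Sum>b\<in>?J. k b *\<^sub>R b)"
      using B(1) C(1) disj by (intro sum.union_disjoint) auto
    also have "(\<Sum>b\<in>?I. k b *\<^sub>R b) = (\<Sum>b\<in>B. (c b *\<^sub>R b, 0))"
      by (simp add: sum.reindex inj_on_def k_def)
    also have "(\<Sum>b\<in>?J. k b *\<^sub>R b) = (\<Sum>b\<in>C - {0}. (0, d b *\<^sub>R b))"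
      by (simp add: sum.reindex inj_on_def k_def)
    also have "(\<Sum>b\<in>B. (c b *\<^sub>R b, 0)) + (\<Sum>b\<in>C - {0}. (0, d b *\<^sub>R b)) = z"
      using c d by (simp add: prod_eq_iff fst_sum snd_sum)
    finally show ?thesis by metis
  qed
  then show "\<exists>D :: ('a \<times> 'b) set. finite D \<and> (\<forall>z. \<exists>k. z = (\<Sum>b\<in>D. k b *\<^sub>R b))"
    using B(1) C(1) by (intro exI[of _ "?I \<union> ?J"]) auto
qed

text \<open>
  \<open>cont_diff k S f\<close>: \<open>f\<close> is \<open>k\<close> times continuously differentiable on the open set \<open>S\<close>, i.e. all
  iterated directional derivatives up to order \<open>k\<close> exist and are continuous.
\<close>

primrec cont_diff ::
  "nat \<Rightarrow> 'e::real_normed_vector set \<Rightarrow> ('e \<Rightarrow> 'f::real_normed_vector) \<Rightarrow> bool" where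
  "cont_diff 0 S f \<longleftrightarrow> continuous_on S f"
| "cont_diff (Suc k) S f \<longleftrightarrow> (\<forall>x\<in>S. f differentiable at x) \<and>
     (\<forall>v. cont_diff k S (\<lambda>x. frechet_derivative f (at x) v))"

definition smooth_on :: "'e::real_normed_vector set \<Rightarrow> ('e \<Rightarrow> 'f::real_normed_vector) \<Rightarrow> bool" where
  "smooth_on S f \<longleftrightarrow> (\<forall>k. cont_diff k S f)"

text \<open>
  A chart is a pair \<open>(U, x)\<close> of a domain and a coordinate map; only the values of \<open>x\<close> on \<open>U\<close> matter.
  The underlying space of a manifold is a whole type, whose topology is given by the type class.
\<close>

type_synonym ('a, 'e) chart = "'a set \<times> ('a \<Rightarrow> 'e)"

abbreviation chart_inv :: "('a, 'e) chart \<Rightarrow> 'e \<Rightarrow> 'a" where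
  "chart_inv c \<equiv> inv_into (fst c) (snd c)"

definition is_chart :: "('a::topological_space, 'e::real_normed_vector) chart \<Rightarrow> bool" where
  "is_chart c \<longleftrightarrow> open (fst c) \<and> open (snd c ` fst c) \<and>
     homeomorphism (fst c) (snd c ` fst c) (snd c) (chart_inv c)"

definition smooth_manifold ::
  "('a::{t2_space,second_countable_topology}, 'e::fin_dim_inner) chart set \<Rightarrow> bool" where
  "smooth_manifold A \<longleftrightarrow> (\<forall>c\<in>A. is_chart c) \<and> (\<Union>c\<in>A. fst c) = UNIV \<and>
     (\<forall>c\<in>A. \<forall>d\<in>A. smooth_on (snd c ` (fst c \<inter> fst d)) (snd d \<circ> chart_inv c))"

definition prod_atlas ::
  "('a, 'e) chart set \<Rightarrow> ('b, 'f) chart set \<Rightarrow> ('a \<times> 'b, 'e \<times> 'f) chart set" where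
  "prod_atlas A B = {(fst c \<times> fst d, map_prod (snd c) (snd d)) | c d. c \<in> A \<and> d \<in> B}"

definition smooth_functions ::
  "('a, 'e::real_normed_vector) chart set \<Rightarrow> ('a \<Rightarrow> real) set" where
  "smooth_functions A = {f. \<forall>c\<in>A. smooth_on (snd c ` fst c) (f \<circ> chart_inv c)}"


section \<open>Tangent vectors, covectors and 1-forms\<close>

text \<open>
  Tangent vectors at \<open>p\<close> are the coordinate derivations \<open>f \<mapsto> D(f \<circ> x\<^sup>-\<^sup>1)(x p) e\<close> of the algebra of
  smooth functions. Tangent vectors, covectors and bivectors are normalised to vanish on arguments
  outside their mathematical domain, so that HOL equality is equality of the geometric objects.
\<close>

type_synonym 'a tvec = "('a \<Rightarrow> real) \<Rightarrow> real"
type_synonym 'a covec = "'a tvec \<Rightarrow> real"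

definition tangent_space ::
  "('a, 'e::real_normed_vector) chart set \<Rightarrow> 'a \<Rightarrow> 'a tvec set" where
  "tangent_space A p = {v. \<exists>c\<in>A. p \<in> fst c \<and> (\<exists>e. v = (\<lambda>f.
     if f \<in> smooth_functions A then frechet_derivative (f \<circ> chart_inv c) (at (snd c p)) e else 0))}"

definition cotangent_space ::
  "('a, 'e::real_normed_vector) chart set \<Rightarrow> 'a \<Rightarrow> 'a covec set" where
  "cotangent_space A p = {a.
     (\<forall>v\<in>tangent_space A p. \<forall>w\<in>tangent_space A p. a (\<lambda>f. v f + w f) = a v + a w) \<and>
     (\<forall>r. \<forall>v\<in>tangent_space A p. a (\<lambda>f. r * v f) = r * a v) \<and>
     (\<forall>v. v \<notin> tangent_space A p \<longrightarrow> a v = 0)}"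

definition smooth_vector_field ::
  "('a, 'e::real_normed_vector) chart set \<Rightarrow> ('a \<Rightarrow> 'a tvec) \<Rightarrow> bool" where
  "smooth_vector_field A X \<longleftrightarrow> (\<forall>p. X p \<in> tangent_space A p) \<and>
     (\<forall>f\<in>smooth_functions A. (\<lambda>p. X p f) \<in> smooth_functions A)"

definition one_forms ::
  "('a, 'e::real_normed_vector) chart set \<Rightarrow> ('a \<Rightarrow> 'a covec) set" where
  "one_forms A = {\<omega>. (\<forall>p. \<omega> p \<in> cotangent_space A p) \<and>
     (\<forall>X. smooth_vector_field A X \<longrightarrow> (\<lambda>p. \<omega> p (X p)) \<in> smooth_functions A)}"

definition differential ::
  "('a, 'e::real_normed_vector) chart set \<Rightarrow> ('a \<Rightarrow> real) \<Rightarrow> 'a \<Rightarrow> 'a covec" where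
  "differential A f = (\<lambda>p v. if v \<in> tangent_space A p then v f else 0)"

text \<open>
  Push-forward of tangent vectors and pull-back of 1-forms along a smooth map \<open>F\<close> from the
  manifold with atlas \<open>A\<close> to the one with atlas \<open>B\<close>.
\<close>

definition push_forward ::
  "('b, 'f::real_normed_vector) chart set \<Rightarrow> ('a \<Rightarrow> 'b) \<Rightarrow> 'a tvec \<Rightarrow> 'b tvec" where
  "push_forward B F v = (\<lambda>g. if g \<in> smooth_functions B then v (g \<circ> F) else 0)"

definition pull_back ::
  "('a, 'e::real_normed_vector) chart set \<Rightarrow> ('b, 'f::real_normed_vector) chart set \<Rightarrow>
   ('a \<Rightarrow> 'b) \<Rightarrow> ('b \<Rightarrow> 'b covec) \<Rightarrow> 'a \<Rightarrow> 'a covec" where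
  "pull_back A B F \<omega> =
     (\<lambda>p v. if v \<in> tangent_space A p then \<omega> (F p) (push_forward B F v) else 0)"

abbreviation horizontal_lift ::
  "('a, 'e::real_normed_vector) chart set \<Rightarrow> ('b, 'f::real_normed_vector) chart set \<Rightarrow>
   ('a \<Rightarrow> 'a covec) \<Rightarrow> 'a \<times> 'b \<Rightarrow> ('a \<times> 'b) covec" where
  "horizontal_lift A1 A2 \<equiv> pull_back (prod_atlas A1 A2) A1 fst"

abbreviation vertical_lift ::
  "('a, 'e::real_normed_vector) chart set \<Rightarrow> ('b, 'f::real_normed_vector) chart set \<Rightarrow>
   ('b \<Rightarrow> 'b covec) \<Rightarrow> 'a \<times> 'b \<Rightarrow> ('a \<times> 'b) covec" where
  "vertical_lift A1 A2 \<equiv> pull_back (prod_atlas A1 A2) A2 snd"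


section \<open>Bivector fields and Poisson manifolds\<close>

type_synonym 'a bivec_field = "'a \<Rightarrow> 'a covec \<Rightarrow> 'a covec \<Rightarrow> real"

text \<open>
  A bivector at \<open>p\<close> is an alternating bilinear form on the cotangent space at \<open>p\<close>. Linearity in the
  second argument follows from antisymmetry.
\<close>

definition bivector_at ::
  "('a, 'e::real_normed_vector) chart set \<Rightarrow> 'a \<Rightarrow> ('a covec \<Rightarrow> 'a covec \<Rightarrow> real) \<Rightarrow> bool" where
  "bivector_at A p P \<longleftrightarrow>
     (\<forall>a\<in>cotangent_space A p. \<forall>b\<in>cotangent_space A p. \<forall>c\<in>cotangent_space A p.
        P (\<lambda>v. a v + b v) c = P a c + P b c) \<and>
     (\<forall>r. \<forall>a\<in>cotangent_space A p. \<forall>b\<in>cotangent_space A p. P (\<lambda>v. r * a v) b = r * P a b) \<and>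
     (\<forall>a\<in>cotangent_space A p. \<forall>b\<in>cotangent_space A p. P b a = - P a b) \<and>
     (\<forall>a b. a \<notin> cotangent_space A p \<or> b \<notin> cotangent_space A p \<longrightarrow> P a b = 0)"

definition bivector_field ::
  "('a, 'e::real_normed_vector) chart set \<Rightarrow> 'a bivec_field \<Rightarrow> bool" where
  "bivector_field A P \<longleftrightarrow> (\<forall>p. bivector_at A p (P p)) \<and>
     (\<forall>\<alpha>\<in>one_forms A. \<forall>\<beta>\<in>one_forms A. (\<lambda>p. P p (\<alpha> p) (\<beta> p)) \<in> smooth_functions A)"

definition bracket ::
  "('a, 'e::real_normed_vector) chart set \<Rightarrow> 'a bivec_field \<Rightarrow>
   ('a \<Rightarrow> real) \<Rightarrow> ('a \<Rightarrow> real) \<Rightarrow> 'a \<Rightarrow> real" where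
  "bracket A P f g = (\<lambda>p. P p (differential A f p) (differential A g p))"

definition poisson_tensor ::
  "('a, 'e::real_normed_vector) chart set \<Rightarrow> 'a bivec_field \<Rightarrow> bool" where
  "poisson_tensor A P \<longleftrightarrow> bivector_field A P \<and>
     (\<forall>f\<in>smooth_functions A. \<forall>g\<in>smooth_functions A. \<forall>h\<in>smooth_functions A. \<forall>p.
        bracket A P f (bracket A P g h) p + bracket A P g (bracket A P h f) p +
        bracket A P h (bracket A P f g) p = 0)"

definition poisson_manifold ::
  "('a::{t2_space,second_countable_topology}, 'e::fin_dim_inner) chart set \<Rightarrow>
   'a bivec_field \<Rightarrow> bool" where
  "poisson_manifold A P \<longleftrightarrow> smooth_manifold A \<and> poisson_tensor A P"

definition anchor ::
  "('a, 'e::real_normed_vector) chart set \<Rightarrow> 'a bivec_field \<Rightarrow> ('a \<Rightarrow> 'a covec) \<Rightarrow> 'a \<Rightarrow> 'a tvec" where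
  "anchor A P \<alpha> = (\<lambda>p. THE v. v \<in> tangent_space A p \<and>
     (\<forall>b\<in>cotangent_space A p. b v = P p (\<alpha> p) b))"

definition hamiltonian_vector_field ::
  "('a, 'e::real_normed_vector) chart set \<Rightarrow> 'a bivec_field \<Rightarrow> ('a \<Rightarrow> real) \<Rightarrow> 'a \<Rightarrow> 'a tvec" where
  "hamiltonian_vector_field A P f = anchor A P (differential A f)"

definition casimir ::
  "('a, 'e::real_normed_vector) chart set \<Rightarrow> 'a bivec_field \<Rightarrow> ('a \<Rightarrow> real) \<Rightarrow> bool" where
  "casimir A P f \<longleftrightarrow> f \<in> smooth_functions A \<and>
     (\<forall>p. hamiltonian_vector_field A P f p = (\<lambda>_. 0))"

definition warped_bivector_field ::
  "('a, 'e::real_normed_vector) chart set \<Rightarrow> 'a bivec_field \<Rightarrow> ('a \<Rightarrow> real) \<Rightarrow>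
   ('b, 'f::real_normed_vector) chart set \<Rightarrow> 'b bivec_field \<Rightarrow> ('a \<times> 'b) bivec_field" where
  "warped_bivector_field A1 P1 \<mu> A2 P2 = (THE P. bivector_field (prod_atlas A1 A2) P \<and>
     (\<forall>\<alpha>\<in>one_forms A1. \<forall>\<beta>\<in>one_forms A1. \<forall>p q.
        P (p, q) (horizontal_lift A1 A2 \<alpha> (p, q)) (horizontal_lift A1 A2 \<beta> (p, q))
          = P1 p (\<alpha> p) (\<beta> p)) \<and>
     (\<forall>\<alpha>\<in>one_forms A2. \<forall>\<beta>\<in>one_forms A2. \<forall>p q.
        P (p, q) (vertical_lift A1 A2 \<alpha> (p, q)) (vertical_lift A1 A2 \<beta> (p, q))
          = \<mu> p * P2 q (\<alpha> q) (\<beta> q)) \<and>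
     (\<forall>\<alpha>\<in>one_forms A1. \<forall>\<beta>\<in>one_forms A2. \<forall>p q.
        P (p, q) (horizontal_lift A1 A2 \<alpha> (p, q)) (vertical_lift A1 A2 \<beta> (p, q)) = 0))"

end

theory Submission
  imports Defs
begin

text \<open>
  On functions, the bracket of the warped bivector field is
  \<open>{F, G}(p, q) = {F(-, q), G(-, q)}\<^sub>1(p) + \<mu>(p) {F(p, -), G(p, -)}\<^sub>2(q)\<close>.
  The Jacobiator of any bivector field depends on each of its arguments only through the differential
  at the point, because second derivatives commute. Every differential at \<open>(p, q)\<close> is that of a sum
  of lifts from the two factors, so the Jacobi identity need only be tested on lifts. There the
  Jacobiator vanishes for three lifts from \<open>M\<^sub>1\<close>, for three from \<open>M\<^sub>2\<close> and for two from \<open>M\<^sub>1\<close> and one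
  from \<open>M\<^sub>2\<close>; for \<open>f\<close> from \<open>M\<^sub>1\<close> and \<open>g, h\<close> from \<open>M\<^sub>2\<close> it equals \<open>{f, \<mu>}\<^sub>1(p) {g, h}\<^sub>2(q)\<close>. Since
  \<open>\<Pi>\<^sub>2 \<noteq> 0\<close>, this vanishes identically if and only if \<open>\<mu>\<close> is Casimir.
\<close>

section \<open>Calculus of smooth functions\<close>

text \<open>The definitions are global: tangent vectors act on smooth functions on the whole
  manifold, and one-forms are tested against global vector fields. The coordinates of a chart
  therefore become usable only after extension by cut-off functions, which rest on the compactness
  of closed balls in the model space and on the Hausdorff property. With them every covector at a
  point is the differential of a global function, and this carries identities from functions to
  arbitrary covectors. A smooth function on the product need not be a sum of lifts; only its
  differential at a given point agrees with that of such a sum. The Jacobiator contains second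
  derivatives, so testing on lifts is legitimate only because these cancel. The warped field is
  given by a definite description, so existence and uniqueness have to be established before its
  bracket can be computed. The model spaces may have dimension 0, so expansions use a finite
  orthonormal family that may be empty.\<close>

lemma cont_diff_cong:
  assumes "open S" "\<And>x. x \<in> S \<Longrightarrow> f x = g x" "cont_diff k S f"
  shows "cont_diff k S g"
  using assms(2,3)
proof (induction k arbitrary: f g)
  case 0
  then show ?case by (auto cong: continuous_on_cong)
next
  case (Suc k)
  have "(g has_derivative frechet_derivative f (at x)) (at x)" if "x \<in> S" for x
    using Suc.prems that assms(1)
    by (auto intro: has_derivative_transform_within_open[where f = f and s = S]
          simp: frechet_derivative_works)
  then have D: "g differentiable at x" "frechet_derivative g (at x) = frechet_derivative f (at x)"
    if "x \<in> S" for x using that by (auto simp: differentiable_def frechet_derivative_at[symmetric])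
  have "cont_diff k S (\<lambda>x. frechet_derivative g (at x) v)" for v
  proof (rule Suc.IH)
    show "cont_diff k S (\<lambda>x. frechet_derivative f (at x) v)" using Suc.prems(2) by simp
  qed (simp add: D)
  then show ?case using D by simp
qed

text \<open>Allows the derivative to be supplied as a formula \<open>f'\<close>; uniqueness of
  derivatives identifies it with the chosen \<open>frechet_derivative\<close> on
  \<open>S\<close>.\<close>

lemma cont_diff_SucI:
  assumes "open S" "\<And>x. x \<in> S \<Longrightarrow> (f has_derivative f' x) (at x)"
    and "\<And>v. cont_diff k S (\<lambda>x. f' x v)"
  shows "cont_diff (Suc k) S f"
proof -
  have "frechet_derivative f (at x) = f' x" if "x \<in> S" for x
    using assms(2)[OF that] by (simp add: frechet_derivative_at[symmetric])
  then show ?thesis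
    using assms by (auto simp: differentiable_def intro: cont_diff_cong[OF assms(1) _ assms(3)])
qed

lemma cont_diff_Suc_has_derivative:
  "cont_diff (Suc k) S f \<Longrightarrow> x \<in> S \<Longrightarrow> (f has_derivative frechet_derivative f (at x)) (at x)"
  by (auto simp: frechet_derivative_works)

lemma cont_diff_Suc_imp: "cont_diff (Suc k) S f \<Longrightarrow> cont_diff k S f"
proof (induction k arbitrary: f)
  case 0
  then show ?case
    by (auto intro!: continuous_at_imp_continuous_on differentiable_imp_continuous_within)
next
  case (Suc k)
  then show ?case by (metis cont_diff.simps(2))
qed

lemma cont_diff_subset: "cont_diff k T f \<Longrightarrow> S \<subseteq> T \<Longrightarrow> cont_diff k S f"
  by (induction k arbitrary: f) (auto intro: continuous_on_subset)

lemma cont_diff_local: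
  assumes "\<And>x. x \<in> S \<Longrightarrow> \<exists>T. open T \<and> x \<in> T \<and> cont_diff k T f"
  shows "cont_diff k S f"
  using assms
proof (induction k arbitrary: f)
  case 0
  show ?case unfolding cont_diff.simps
  proof (rule continuous_at_imp_continuous_on, rule ballI)
    fix x assume "x \<in> S"
    then obtain T where "open T" "x \<in> T" "cont_diff 0 T f" using 0 by blast
    then show "isCont f x" by (auto simp: continuous_on_eq_continuous_at)
  qed
next
  case (Suc k)
  show ?case unfolding cont_diff.simps
  proof (intro conjI ballI allI Suc.IH)
    fix x assume "x \<in> S"
    then obtain T where T: "open T" "x \<in> T" "cont_diff (Suc k) T f" using Suc by blast
    then show "f differentiable at x" by auto
    show "\<exists>T. open T \<and> x \<in> T \<and> cont_diff k T (\<lambda>x. frechet_derivative f (at x) v)" for v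
      using T by auto
  qed
qed

lemma cont_diff_const: "cont_diff k S (\<lambda>_. c)"
  by (induction k arbitrary: c) auto

lemma cont_diff_linear_compose:
  assumes "bounded_linear L" "open S" "cont_diff k S f"
  shows "cont_diff k S (\<lambda>x. L (f x))"
  using assms(3)
proof (induction k arbitrary: f)
  case 0
  then show ?case by (auto intro!: bounded_linear.continuous_on[OF assms(1)])
next
  case (Suc k)
  show ?case
    by (rule cont_diff_SucI[OF assms(2), where f' = "\<lambda>x v. L (frechet_derivative f (at x) v)"])
       (use Suc in \<open>auto intro!: bounded_linear.has_derivative[OF assms(1)]
          intro: cont_diff_Suc_has_derivative\<close>)
qed

lemma cont_diff_add:
  assumes "open S" "cont_diff k S f" "cont_diff k S g"
  shows "cont_diff k S (\<lambda>x. f x + g x)"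
  using assms(2,3)
proof (induction k arbitrary: f g)
  case 0
  then show ?case by (auto intro!: continuous_intros)
next
  case (Suc k)
  show ?case
    by (rule cont_diff_SucI[OF assms(1),
          where f' = "\<lambda>x v. frechet_derivative f (at x) v + frechet_derivative g (at x) v"])
       (use Suc in \<open>auto intro!: has_derivative_add intro: cont_diff_Suc_has_derivative\<close>)
qed

lemma cont_diff_sum:
  assumes "open S" "\<And>i. i \<in> I \<Longrightarrow> cont_diff k S (f i)"
  shows "cont_diff k S (\<lambda>x. \<Sum>i\<in>I. f i x)"
  using assms(2)
  by (induction I rule: infinite_finite_induct) (auto intro!: cont_diff_const cont_diff_add assms(1))

text \<open>The Leibniz rule expresses the derivative through the same bilinear map applied to the
  functions and their derivatives, so induction on the order closes.\<close>

lemma cont_diff_bilinear: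
  assumes "bounded_bilinear b" "open S" "cont_diff k S f" "cont_diff k S g"
  shows "cont_diff k S (\<lambda>x. b (f x) (g x))"
  using assms(3,4)
proof (induction k arbitrary: f g)
  case 0
  then show ?case by (auto intro!: bounded_bilinear.continuous_on[OF assms(1)])
next
  case (Suc k)
  show ?case
  proof (rule cont_diff_SucI[OF assms(2),
      where f' = "\<lambda>x v. b (f x) (frechet_derivative g (at x) v) + b (frechet_derivative f (at x) v) (g x)"])
    show "((\<lambda>x. b (f x) (g x)) has_derivative
        (\<lambda>v. b (f x) (frechet_derivative g (at x) v) + b (frechet_derivative f (at x) v) (g x))) (at x)"
      if "x \<in> S" for x
      using Suc.prems that by (intro bounded_bilinear.FDERIV[OF assms(1)] cont_diff_Suc_has_derivative)
    show "cont_diff k S (\<lambda>x. b (f x) (frechet_derivative g (at x) v) + b (frechet_derivative f (at x) v) (g x))" for v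
      using Suc.prems cont_diff_Suc_imp[OF Suc.prems(1)] cont_diff_Suc_imp[OF Suc.prems(2)]
      by (auto intro!: cont_diff_add assms(2) Suc.IH simp del: cont_diff.simps(2)) (auto)
  qed
qed

text \<open>The class supplies only a finite spanning set. Orthogonalising it, dropping 0 and
  normalising gives a family for which the coefficients are the linear functions
  \<open>x \<bullet> b\<close>; in dimension 0 it is empty.\<close>

lemma finite_orthonormal_expansion:
  obtains B :: "'e::fin_dim_inner set"
  where "finite B" "\<forall>x. x = (\<Sum>b\<in>B. (x \<bullet> b) *\<^sub>R b)"
proof -
  obtain S :: "'e set" where S: "finite S" "\<And>x. \<exists>c. x = (\<Sum>b\<in>S. c b *\<^sub>R b)"
    using finite_spanning_set by blast
  obtain C where C: "finite C" "span C = span S" "pairwise orthogonal C"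
    using basis_orthogonal[OF S(1)] by blast
  define D where "D = (\<lambda>c. c /\<^sub>R norm c) ` (C - {0})"
  have "x = (\<Sum>b\<in>D. (x \<bullet> b) *\<^sub>R b)" for x
  proof -
    obtain c where "x = (\<Sum>b\<in>S. c b *\<^sub>R b)" using S(2) by blast
    then have "x \<in> span C" unfolding C(2) by (simp add: span_sum span_scale span_base)
    then obtain k where "x = (\<Sum>b\<in>C. k b *\<^sub>R b)"
      unfolding span_finite[OF C(1)] by blast
    also have "\<dots> = (\<Sum>b\<in>C-{0}. k b *\<^sub>R b)"
      using C(1) by (intro sum.mono_neutral_right) auto
    finally have x: "x = (\<Sum>b\<in>C-{0}. k b *\<^sub>R b)" .
    have xb: "x \<bullet> b = k b * (b \<bullet> b)" if "b \<in> C - {0}" for b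
    proof -
      have "x \<bullet> b = (\<Sum>b'\<in>C-{0}. k b' * (b' \<bullet> b))" by (subst x) (simp add: inner_sum_left)
      also have "\<dots> = (\<Sum>b'\<in>C-{0}. if b' = b then k b * (b \<bullet> b) else 0)"
        using C(3) that by (intro sum.cong) (auto simp: pairwise_def orthogonal_def)
      finally show ?thesis using that C(1) by simp
    qed
    \<comment> \<open>Two distinct orthogonal vectors with the same normalisation would make that
      unit vector orthogonal to itself. Injectivity is what reindexes the sum over
      \<open>D\<close>.\<close>
    have inj: "inj_on (\<lambda>c. c /\<^sub>R norm c) (C - {0})"
    proof (rule inj_onI, rule ccontr)
      fix a b assume ab: "a \<in> C - {0}" "b \<in> C - {0}" "a /\<^sub>R norm a = b /\<^sub>R norm b" "a \<noteq> b"
      then have "a \<bullet> b = 0" using C(3) by (auto simp: pairwise_def orthogonal_def)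
      then have "(a /\<^sub>R norm a) \<bullet> (b /\<^sub>R norm b) = 0" by simp
      then have "b /\<^sub>R norm b = 0" unfolding ab(3) by (simp only: inner_eq_zero_iff)
      then show False using ab by auto
    qed
    have "(\<Sum>b\<in>D. (x \<bullet> b) *\<^sub>R b) = (\<Sum>b\<in>C-{0}. k b *\<^sub>R b)"
      unfolding D_def sum.reindex[OF inj] using xb
      by (intro sum.cong) (auto simp: dot_square_norm power2_eq_square)
    then show ?thesis using x by simp
  qed
  moreover have "finite D" using C(1) by (simp add: D_def)
  ultimately show ?thesis using that by blast
qed

text \<open>The chain rule produces a derivative of \<open>g\<close> in the direction
  \<open>?f' x v\<close>, which varies with \<open>x\<close>, while \<open>cont_diff\<close>
  controls only fixed directions. Expanding the direction along a finite basis leaves sums of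
  products of functions of order \<open>k\<close>.\<close>

lemma cont_diff_compose:
  fixes f :: "'e::real_normed_vector \<Rightarrow> 'f::fin_dim_inner"
  assumes "open S" "open T" "f ` S \<subseteq> T" "cont_diff k S f" "cont_diff k T g"
  shows "cont_diff k S (\<lambda>x. g (f x))"
  using assms(4,5)
proof (induction k arbitrary: g)
  case 0
  then show ?case using assms(3) by (auto intro: continuous_on_compose2)
next
  case (Suc k)
  obtain B :: "'f set" where B: "finite B" "\<forall>x. x = (\<Sum>b\<in>B. (x \<bullet> b) *\<^sub>R b)"
    by (rule finite_orthonormal_expansion)
  let ?f' = "\<lambda>x. frechet_derivative f (at x)" and ?g' = "\<lambda>x. frechet_derivative g (at x)"
  have D: "((\<lambda>x. g (f x)) has_derivative (\<lambda>v. ?g' (f x) (?f' x v))) (at x)" if "x \<in> S" for x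
    using that assms(3) Suc.prems
    by (intro has_derivative_compose[of f "?f' x" x UNIV g] cont_diff_Suc_has_derivative) auto
  show ?case
  proof (rule cont_diff_SucI[OF assms(1) D])
    fix v
    have "cont_diff k S (\<lambda>x. \<Sum>b\<in>B. (?f' x v \<bullet> b) *\<^sub>R ?g' (f x) b)"
    proof (intro cont_diff_sum assms(1) cont_diff_bilinear[OF bounded_bilinear_scaleR])
      show "cont_diff k S (\<lambda>x. ?f' x v \<bullet> b)" for b
        using Suc.prems by (intro cont_diff_linear_compose[OF bounded_linear_inner_left] assms(1)) auto
      have "cont_diff k S f" using Suc.prems(1) by (rule cont_diff_Suc_imp)
      moreover have "cont_diff k T (\<lambda>y. ?g' y b)" for b using Suc.prems(2) by simp
      ultimately show "cont_diff k S (\<lambda>x. ?g' (f x) b)" for b by (rule Suc.IH)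
    qed
    then show "cont_diff k S (\<lambda>x. ?g' (f x) (?f' x v))"
    proof (rule cont_diff_cong[OF assms(1), rotated])
      fix x assume "x \<in> S"
      then have L: "linear (?g' (f x))"
        using cont_diff_Suc_has_derivative[OF Suc.prems(2)] assms(3)
        by (intro bounded_linear.linear has_derivative_bounded_linear) auto
      show "(\<Sum>b\<in>B. (?f' x v \<bullet> b) *\<^sub>R ?g' (f x) b) = ?g' (f x) (?f' x v)"
        by (subst (2) B(2)[rule_format]) (simp add: linear_sum[OF L] linear_scale[OF L])
    qed
  qed
qed

lemma smooth_on_cong:
  "open S \<Longrightarrow> (\<And>x. x \<in> S \<Longrightarrow> f x = g x) \<Longrightarrow> smooth_on S f \<Longrightarrow> smooth_on S g"
  unfolding smooth_on_def by (metis cont_diff_cong)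

lemma smooth_on_has_derivative:
  "smooth_on S f \<Longrightarrow> x \<in> S \<Longrightarrow> (f has_derivative frechet_derivative f (at x)) (at x)"
  unfolding smooth_on_def by (metis cont_diff_Suc_has_derivative)

lemma smooth_on_frechet_derivative:
  "smooth_on S f \<Longrightarrow> smooth_on S (\<lambda>x. frechet_derivative f (at x) v)"
  unfolding smooth_on_def by (metis cont_diff.simps(2))

lemma smooth_on_continuous: "smooth_on S f \<Longrightarrow> continuous_on S f"
  unfolding smooth_on_def by (metis cont_diff.simps(1))

lemma smooth_on_subset: "smooth_on T f \<Longrightarrow> S \<subseteq> T \<Longrightarrow> smooth_on S f"
  unfolding smooth_on_def by (metis cont_diff_subset)

lemma smooth_on_local:
  "(\<And>x. x \<in> S \<Longrightarrow> \<exists>T. open T \<and> x \<in> T \<and> smooth_on T f) \<Longrightarrow> smooth_on S f"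
  unfolding smooth_on_def by (metis cont_diff_local)

lemma smooth_on_const: "smooth_on S (\<lambda>_. c)"
  unfolding smooth_on_def by (metis cont_diff_const)

lemma smooth_on_linear_compose:
  "bounded_linear L \<Longrightarrow> open S \<Longrightarrow> smooth_on S f \<Longrightarrow> smooth_on S (\<lambda>x. L (f x))"
  unfolding smooth_on_def by (metis cont_diff_linear_compose)

lemma smooth_on_id: "smooth_on S (\<lambda>x. x)"
  unfolding smooth_on_def
proof
  fix k show "cont_diff k S (\<lambda>x. x)"
    by (cases k) (auto intro: cont_diff_const continuous_intros)
qed

lemma smooth_on_linear: "bounded_linear L \<Longrightarrow> open S \<Longrightarrow> smooth_on S L"
  using smooth_on_linear_compose smooth_on_id by fast

lemma smooth_on_add:
  "open S \<Longrightarrow> smooth_on S f \<Longrightarrow> smooth_on S g \<Longrightarrow> smooth_on S (\<lambda>x. f x + g x)"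
  unfolding smooth_on_def by (metis cont_diff_add)

lemma smooth_on_bilinear:
  "bounded_bilinear b \<Longrightarrow> open S \<Longrightarrow> smooth_on S f \<Longrightarrow> smooth_on S g \<Longrightarrow>
    smooth_on S (\<lambda>x. b (f x) (g x))"
  unfolding smooth_on_def by (metis cont_diff_bilinear)

lemmas smooth_on_mult = smooth_on_bilinear[OF bounded_bilinear_mult]

lemma smooth_on_compose:
  fixes f :: "'e::real_normed_vector \<Rightarrow> 'f::fin_dim_inner"
  shows "open S \<Longrightarrow> open T \<Longrightarrow> f ` S \<subseteq> T \<Longrightarrow> smooth_on S f \<Longrightarrow> smooth_on T g \<Longrightarrow>
    smooth_on S (\<lambda>x. g (f x))"
  unfolding smooth_on_def by (metis cont_diff_compose)

lemma smooth_on_Pair: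
  assumes "open S" "smooth_on S f" "smooth_on S g"
  shows "smooth_on S (\<lambda>x. (f x, g x))"
proof -
  have "bounded_linear (\<lambda>x. (x, 0))" "bounded_linear (\<lambda>x. (0, x))"
    by (auto intro!: bounded_linear_Pair bounded_linear_ident bounded_linear_zero)
  then have "smooth_on S (\<lambda>x. (f x, 0) + (0, g x))"
    using assms by (intro smooth_on_add smooth_on_linear_compose[where L = "\<lambda>x. (x, 0)"]
        smooth_on_linear_compose[where L = "\<lambda>x. (0, x)"])
  then show ?thesis by simp
qed

text \<open>The derivative of \<open>1/f\<close> is a product of \<open>1/f\<close> twice with the
  derivative of \<open>f\<close>, so order \<open>k\<close> for \<open>1/f\<close> itself yields
  order \<open>k + 1\<close>.\<close>

lemma smooth_on_inverse:
  fixes f :: "'e::real_normed_vector \<Rightarrow> real"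
  assumes "open S" "smooth_on S f" "\<And>x. x \<in> S \<Longrightarrow> f x \<noteq> 0"
  shows "smooth_on S (\<lambda>x. inverse (f x))"
  unfolding smooth_on_def
proof
  fix k
  show "cont_diff k S (\<lambda>x. inverse (f x))"
  proof (induction k)
    case 0
    then show ?case using assms smooth_on_continuous[OF assms(2)] by (auto intro!: continuous_intros)
  next
    case (Suc k)
    have "cont_diff k S (\<lambda>x. frechet_derivative f (at x) v)" for v
      using smooth_on_frechet_derivative[OF assms(2)] by (auto simp: smooth_on_def)
    then have "cont_diff k S (\<lambda>x. - (inverse (f x) * frechet_derivative f (at x) v * inverse (f x)))" for v
      by (intro cont_diff_linear_compose[OF bounded_linear_minus[OF bounded_linear_ident]]
          cont_diff_bilinear[OF bounded_bilinear_mult] assms(1) Suc)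
    moreover have "((\<lambda>x. inverse (f x)) has_derivative
        (\<lambda>v. - (inverse (f x) * frechet_derivative f (at x) v * inverse (f x)))) (at x)" if "x \<in> S" for x
      using assms(3) smooth_on_has_derivative[OF assms(2)] that by (intro Deriv.has_derivative_inverse) auto
    ultimately show ?case by (intro cont_diff_SucI[OF assms(1)])
  qed
qed

section \<open>Symmetry of second derivatives\<close>

lemma second_difference_mean_value:
  fixes f :: "'e::real_normed_vector \<Rightarrow> real"
  assumes S: "\<And>s r. 0 \<le> s \<Longrightarrow> s \<le> t \<Longrightarrow> 0 \<le> r \<Longrightarrow> r \<le> t \<Longrightarrow> z + s *\<^sub>R u + r *\<^sub>R v \<in> S"
    and f: "smooth_on S f" and t: "t > 0"
  obtains s r where "0 < s" "s < t" "0 < r" "r < t"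
    "f (z + t *\<^sub>R u + t *\<^sub>R v) - f (z + t *\<^sub>R u) - f (z + t *\<^sub>R v) + f z =
     t * t * frechet_derivative (\<lambda>x. frechet_derivative f (at x) u) (at (z + s *\<^sub>R u + r *\<^sub>R v)) v"
proof -
  have line: "((\<lambda>s. g (a + s *\<^sub>R w)) has_field_derivative frechet_derivative g (at (a + s *\<^sub>R w)) w) (at s)"
    if "smooth_on S g" "a + s *\<^sub>R w \<in> S" for g :: "'e \<Rightarrow> real" and a w s
  proof -
    note D = smooth_on_has_derivative[OF that]
    have "((\<lambda>s. a + s *\<^sub>R w) has_derivative (\<lambda>h. h *\<^sub>R w)) (at s)"
      by (auto intro!: derivative_eq_intros)
    from has_derivative_compose[OF this D]
    have "((\<lambda>s. g (a + s *\<^sub>R w)) has_derivative (\<lambda>h. frechet_derivative g (at (a + s *\<^sub>R w)) (h *\<^sub>R w))) (at s)" .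
    moreover have "(\<lambda>h. frechet_derivative g (at (a + s *\<^sub>R w)) (h *\<^sub>R w)) =
        (*) (frechet_derivative g (at (a + s *\<^sub>R w)) w)"
      using linear_scale[OF bounded_linear.linear[OF has_derivative_bounded_linear[OF D]]]
      by (intro ext) simp
    ultimately show ?thesis by (simp add: has_field_derivative_def)
  qed
  \<comment> \<open>The increment of \<open>?\<phi>\<close> over \<open>[0, t]\<close> is the second
    difference. Its derivative is a first difference of \<open>?g\<close> along \<open>v\<close>, so
    the mean value theorem applies once in direction \<open>u\<close> and once more in direction
    \<open>v\<close>.\<close>
  let ?\<phi> = "\<lambda>s. f ((z + t *\<^sub>R v) + s *\<^sub>R u) - f (z + s *\<^sub>R u)"
  have "\<exists>s. 0 < s \<and> s < t \<and> ?\<phi> t - ?\<phi> 0 = (t - 0) *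
      (frechet_derivative f (at ((z + t *\<^sub>R v) + s *\<^sub>R u)) u - frechet_derivative f (at (z + s *\<^sub>R u)) u)"
  proof (rule MVT2[OF t], intro DERIV_diff line f)
    fix s assume "0 \<le> s" "s \<le> t"
    then show "z + t *\<^sub>R v + s *\<^sub>R u \<in> S" "z + s *\<^sub>R u \<in> S"
      using S[of s t] S[of s 0] t by (auto simp: algebra_simps)
  qed
  then obtain s where s: "0 < s" "s < t" "?\<phi> t - ?\<phi> 0 = t *
      (frechet_derivative f (at ((z + t *\<^sub>R v) + s *\<^sub>R u)) u - frechet_derivative f (at (z + s *\<^sub>R u)) u)"
    by auto
  let ?g = "\<lambda>x. frechet_derivative f (at x) u"
  have "\<exists>r. 0 < r \<and> r < t \<and> ?g ((z + s *\<^sub>R u) + t *\<^sub>R v) - ?g ((z + s *\<^sub>R u) + 0 *\<^sub>R v) =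
      (t - 0) * frechet_derivative ?g (at ((z + s *\<^sub>R u) + r *\<^sub>R v)) v"
    using s by (intro MVT2[OF t] line smooth_on_frechet_derivative f S) auto
  then obtain r where r: "0 < r" "r < t" "?g ((z + s *\<^sub>R u) + t *\<^sub>R v) - ?g (z + s *\<^sub>R u) =
      t * frechet_derivative ?g (at ((z + s *\<^sub>R u) + r *\<^sub>R v)) v"
    by auto
  have "z + t *\<^sub>R v + s *\<^sub>R u = (z + s *\<^sub>R u) + t *\<^sub>R v" by simp
  with s(3) r(3) have "?\<phi> t - ?\<phi> 0 = t * (t * frechet_derivative ?g (at ((z + s *\<^sub>R u) + r *\<^sub>R v)) v)"
    by simp
  moreover have "?\<phi> t - ?\<phi> 0 = f (z + t *\<^sub>R u + t *\<^sub>R v) - f (z + t *\<^sub>R u) - f (z + t *\<^sub>R v) + f z"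
    by (simp add: algebra_simps)
  ultimately show ?thesis using that[of s r] s r by (simp add: mult.assoc)
qed

text \<open>The second difference is symmetric in \<open>u\<close> and \<open>v\<close>, and divided
  by \<open>t * t\<close> it is a value of either mixed derivative at some point near
  \<open>z\<close>. Continuity of both then forces equality at \<open>z\<close>.\<close>

lemma frechet_derivative_commute:
  fixes f :: "'e::real_normed_vector \<Rightarrow> real"
  assumes "open S" "smooth_on S f" "z \<in> S"
  shows "frechet_derivative (\<lambda>x. frechet_derivative f (at x) u) (at z) v =
         frechet_derivative (\<lambda>x. frechet_derivative f (at x) v) (at z) u"
proof (rule ccontr)
  let ?D = "\<lambda>u v z. frechet_derivative (\<lambda>x. frechet_derivative f (at x) u) (at z) v"
  assume ne: "?D u v z \<noteq> ?D v u z"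
  \<comment> \<open>Half the supposed gap: two values that coincide and lie within \<open>e\<close>
    of the two mixed derivatives contradict it.\<close>
  define e where "e = \<bar>?D u v z - ?D v u z\<bar> / 2"
  have e: "e > 0" using ne by (simp add: e_def)
  have "isCont (?D u v) z" for u v
    using smooth_on_continuous[OF smooth_on_frechet_derivative[OF smooth_on_frechet_derivative[OF assms(2)]]]
      assms by (auto simp: continuous_on_eq_continuous_at)
  then have "\<exists>d>0. \<forall>y. dist y z < d \<longrightarrow> dist (?D u v y) (?D u v z) < e" for u v
    using e by (auto simp: continuous_at_eps_delta)
  then obtain d1 d2 d3 where d: "d1 > 0" "\<And>y. dist y z < d1 \<Longrightarrow> dist (?D u v y) (?D u v z) < e"
    "d2 > 0" "\<And>y. dist y z < d2 \<Longrightarrow> dist (?D v u y) (?D v u z) < e"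
    and d3: "d3 > 0" "ball z d3 \<subseteq> S"
    using assms(1,3) by (metis open_contains_ball)
  define d where "d = Min {d1, d2, d3}"
  have dpos: "d > 0" using d d3 by (simp add: d_def)
  \<comment> \<open>Small enough for the whole parallelogram spanned by \<open>t *\<^sub>R u\<close>
    and \<open>t *\<^sub>R v\<close> to stay within distance \<open>d\<close> of \<open>z\<close>;
    the summand 1 covers \<open>u = v = 0\<close>.\<close>
  define t where "t = d / (norm u + norm v + 1)"
  have n: "norm u + norm v + 1 > 0" by (smt (verit) norm_ge_zero)
  have t: "t > 0" using dpos n by (simp add: t_def)
  have tn: "t * (norm u + norm v) < d"
  proof -
    have "t * (norm u + norm v) < t * (norm u + norm v + 1)" using t by simp
    also have "\<dots> = d" using n by (simp add: t_def)
    finally show ?thesis .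
  qed
  have near: "dist (z + s *\<^sub>R u + r *\<^sub>R v) z < d" if "0 \<le> s" "s \<le> t" "0 \<le> r" "r \<le> t" for s r
  proof -
    have "dist (z + s *\<^sub>R u + r *\<^sub>R v) z \<le> s * norm u + r * norm v"
      using that norm_triangle_ineq[of "s *\<^sub>R u" "r *\<^sub>R v"] by (simp add: dist_norm)
    also have "\<dots> \<le> t * norm u + t * norm v"
      using that by (intro add_mono mult_right_mono) auto
    finally show ?thesis using tn by (simp add: algebra_simps)
  qed
  have inS: "z + s *\<^sub>R u + r *\<^sub>R v \<in> S" if "0 \<le> s" "s \<le> t" "0 \<le> r" "r \<le> t" for s r
    using near[OF that] d3 by (auto simp: d_def dist_commute)
  obtain s r where sr: "0 < s" "s < t" "0 < r" "r < t"
    "f (z + t *\<^sub>R u + t *\<^sub>R v) - f (z + t *\<^sub>R u) - f (z + t *\<^sub>R v) + f z = t * t * ?D u v (z + s *\<^sub>R u + r *\<^sub>R v)"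
    using second_difference_mean_value[OF inS assms(2) t] by blast
  have "z + s *\<^sub>R v + r *\<^sub>R u \<in> S" if "0 \<le> s" "s \<le> t" "0 \<le> r" "r \<le> t" for s r
    using inS[OF that(3,4,1,2)] by (simp add: algebra_simps)
  then obtain s' r' where sr': "0 < s'" "s' < t" "0 < r'" "r' < t"
    "f (z + t *\<^sub>R v + t *\<^sub>R u) - f (z + t *\<^sub>R v) - f (z + t *\<^sub>R u) + f z = t * t * ?D v u (z + s' *\<^sub>R v + r' *\<^sub>R u)"
    using second_difference_mean_value[of t z v u S f, OF _ assms(2) t] by blast
  have "z + t *\<^sub>R v + t *\<^sub>R u = z + t *\<^sub>R u + t *\<^sub>R v" by simp
  then have "t * t * ?D u v (z + s *\<^sub>R u + r *\<^sub>R v) = t * t * ?D v u (z + s' *\<^sub>R v + r' *\<^sub>R u)"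
    using sr(5) sr'(5) by (simp add: algebra_simps)
  then have "?D u v (z + s *\<^sub>R u + r *\<^sub>R v) = ?D v u (z + s' *\<^sub>R v + r' *\<^sub>R u)"
    using t by simp
  moreover have "dist (?D u v (z + s *\<^sub>R u + r *\<^sub>R v)) (?D u v z) < e"
    using near[of s r] sr by (intro d) (auto simp: d_def)
  moreover have "dist (?D v u (z + s' *\<^sub>R v + r' *\<^sub>R u)) (?D v u z) < e"
    using near[of r' s'] sr' by (intro d) (auto simp: d_def algebra_simps)
  ultimately have "\<bar>?D u v z - ?D v u z\<bar> < 2 * e" by (auto simp: dist_real_def)
  then show False by (simp add: e_def)
qed

section \<open>Bump functions\<close>

text \<open>For \<open>n = 0\<close> this is the classical smooth function that vanishes to infinite
  order at 0. The negative powers of \<open>t\<close> are included because differentiation produces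
  them, so that derivatives stay in the span of the family.\<close>

definition flat :: "nat \<Rightarrow> real \<Rightarrow> real" where
  "flat n t = (if t > 0 then inverse t ^ n * exp (- inverse t) else 0)"

lemma flat_tendsto_0: "(flat n \<longlongrightarrow> 0) (at 0)"
proof (rule filterlim_split_at)
  have "(flat n \<longlongrightarrow> 0) (at_left 0) = ((\<lambda>_. 0 :: real) \<longlongrightarrow> 0) (at_left (0::real))"
    by (rule filterlim_cong) (auto simp: flat_def eventually_at_filter)
  then show "(flat n \<longlongrightarrow> 0) (at_left 0)" by simp
  \<comment> \<open>The substitution of \<open>1/t\<close> turns the limit into the decay of a power
    against the exponential at infinity.\<close>
  have "((\<lambda>t. inverse t ^ n / exp (inverse t)) \<longlongrightarrow> 0) (at_right (0::real))"
    by (rule filterlim_compose[OF tendsto_power_div_exp_0 filterlim_inverse_at_top_right])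
  moreover have "(flat n \<longlongrightarrow> 0) (at_right 0) =
      ((\<lambda>t. inverse t ^ n / exp (inverse t)) \<longlongrightarrow> 0) (at_right (0::real))"
    by (rule filterlim_cong)
       (auto simp: flat_def eventually_at_filter exp_minus divide_inverse)
  ultimately show "(flat n \<longlongrightarrow> 0) (at_right 0)" by simp
qed

lemma flat_has_derivative:
  "(flat n has_field_derivative (flat (n + 2) t - real n * flat (n + 1) t)) (at t)"
proof -
  consider "t < 0" | "t = 0" | "t > 0" by linarith
  then show ?thesis
  proof cases
    case 1
    have "((\<lambda>_. 0) has_field_derivative 0) (at t)" by simp
    then have "(flat n has_field_derivative 0) (at t)"
      by (rule has_field_derivative_transform_within_open[where S = "{..<0}"])
         (use 1 in \<open>auto simp: flat_def\<close>)
    then show ?thesis using 1 by (simp add: flat_def)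
  next
    case 2
    \<comment> \<open>Division by \<open>t\<close> only raises the exponent, so the difference
      quotient at 0 is again a member of the family.\<close>
    have "((\<lambda>t. (flat n t - flat n 0) / (t - 0)) \<longlongrightarrow> 0) (at 0) = (flat (Suc n) \<longlongrightarrow> 0) (at 0)"
      by (rule filterlim_cong) (auto simp: flat_def eventually_at_filter divide_inverse)
    then have "(flat n has_field_derivative 0) (at 0)"
      using flat_tendsto_0 by (simp add: has_field_derivative_iff)
    then show ?thesis using 2 by (simp add: flat_def)
  next
    case 3
    have "((\<lambda>t. inverse t ^ n * exp (- inverse t)) has_field_derivative
        real n * inverse t ^ (n - Suc 0) * (- (inverse t * inverse t)) * exp (- inverse t) +
        inverse t ^ n * (exp (- inverse t) * (inverse t * inverse t))) (at t)"
      using 3 by (auto intro!: derivative_eq_intros simp: algebra_simps)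
    also have "real n * inverse t ^ (n - Suc 0) * (- (inverse t * inverse t)) * exp (- inverse t) +
        inverse t ^ n * (exp (- inverse t) * (inverse t * inverse t)) =
        flat (n + 2) t - real n * flat (n + 1) t"
      using 3 by (cases n) (simp_all add: flat_def algebra_simps)
    finally show ?thesis
      by (rule has_field_derivative_transform_within_open[where S = "{0<..}"])
         (use 3 in \<open>auto simp: flat_def\<close>)
  qed
qed

lemma smooth_on_flat: "smooth_on UNIV (flat n)"
  unfolding smooth_on_def
proof
  fix k show "cont_diff k UNIV (flat n)"
  proof (induction k arbitrary: n)
    case 0
    show ?case
      using DERIV_isCont[OF flat_has_derivative] by (simp add: continuous_at_imp_continuous_on)
  next
    case (Suc k)
    have "cont_diff k UNIV (\<lambda>t. v * (flat (n + 2) t + (- real n) * flat (n + 1) t))" for v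
      by (intro cont_diff_linear_compose[OF bounded_linear_mult_right] cont_diff_add Suc) auto
    moreover have "(flat n has_derivative (\<lambda>v. v * (flat (n + 2) t + (- real n) * flat (n + 1) t))) (at t)" for t
      using flat_has_derivative[of n t]
      by (simp add: has_field_derivative_def mult.commute[of _ "flat _ _ - _"])
    ultimately show ?case by (intro cont_diff_SucI) auto
  qed
qed

lemma smooth_step:
  obtains g :: "real \<Rightarrow> real"
  where "smooth_on UNIV g" "\<And>t. t \<le> 0 \<Longrightarrow> g t = 0" "\<And>t. t \<ge> 1 \<Longrightarrow> g t = 1"
proof
  \<comment> \<open>The quotient of \<open>flat 0 t\<close> by
    \<open>flat 0 t + flat 0 (1 - t)\<close>. The denominator is positive because \<open>t\<close>
    or \<open>1 - t\<close> is, and one of its summands vanishes outside the open unit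
    interval.\<close>
  let ?g = "\<lambda>t. flat 0 t * inverse (flat 0 t + flat 0 (1 + (-1) * t))"
  have "smooth_on UNIV (\<lambda>t. flat 0 (1 + (-1) * t))"
    by (rule smooth_on_compose[OF open_UNIV open_UNIV subset_UNIV _ smooth_on_flat])
       (intro smooth_on_add smooth_on_const smooth_on_mult smooth_on_id open_UNIV)
  then have "smooth_on UNIV (\<lambda>t. flat 0 t + flat 0 (1 + (-1) * t))"
    by (intro smooth_on_add smooth_on_flat open_UNIV)
  moreover have "flat 0 t + flat 0 (1 + (-1) * t) \<noteq> 0" for t
  proof -
    have "flat 0 t \<ge> 0" "flat 0 (1 - t) \<ge> 0" "flat 0 t > 0 \<or> flat 0 (1 - t) > 0"
      by (auto simp: flat_def)
    then show ?thesis by auto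
  qed
  ultimately have "smooth_on UNIV (\<lambda>t. inverse (flat 0 t + flat 0 (1 + (-1) * t)))"
    by (intro smooth_on_inverse open_UNIV)
  then show "smooth_on UNIV ?g"
    by (intro smooth_on_mult smooth_on_flat open_UNIV)
qed (auto simp: flat_def)

lemma smooth_bump:
  fixes z\<^sub>0 :: "'e::real_inner"
  assumes "r > 0"
  obtains \<psi> :: "'e \<Rightarrow> real"
  where "smooth_on UNIV \<psi>" "\<forall>z\<in>ball z\<^sub>0 (r / 2). \<psi> z = 1" "\<forall>z. z \<notin> ball z\<^sub>0 r \<longrightarrow> \<psi> z = 0"
proof -
  obtain g :: "real \<Rightarrow> real" where g: "smooth_on UNIV g" "\<And>t. t \<le> 0 \<Longrightarrow> g t = 0" "\<And>t. t \<ge> 1 \<Longrightarrow> g t = 1"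
    using smooth_step by blast
  \<comment> \<open>The squared distance keeps the argument smooth at the centre. The constants give
    a value at least 1 up to distance \<open>r / 2\<close> and at most 0 from distance
    \<open>r\<close> on, which are the thresholds of the step function.\<close>
  let ?q = "\<lambda>z::'e. 2 + (- 2 / r\<^sup>2) * ((z + - z\<^sub>0) \<bullet> (z + - z\<^sub>0))"
  have "smooth_on UNIV ?q"
    by (intro smooth_on_add smooth_on_const smooth_on_mult
        smooth_on_bilinear[OF bounded_bilinear_inner] smooth_on_id open_UNIV)
  then have "smooth_on UNIV (\<lambda>z. g (?q z))"
    by (intro smooth_on_compose[OF _ _ _ _ g(1)]) auto
  moreover have q: "?q z = 2 - 2 * (dist z\<^sub>0 z)\<^sup>2 / r\<^sup>2" for z
    by (simp add: norm_minus_commute[of z\<^sub>0] dist_norm power2_norm_eq_inner[symmetric])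
  moreover have "?q z \<ge> 1" if "z \<in> ball z\<^sub>0 (r / 2)" for z
  proof -
    have "(dist z\<^sub>0 z)\<^sup>2 \<le> (r / 2)\<^sup>2" using that by (intro power_mono) auto
    moreover have "(r / 2)\<^sup>2 = r\<^sup>2 / 4" by (simp add: power_divide)
    moreover have "0 \<le> (dist z\<^sub>0 z)\<^sup>2" by simp
    ultimately have "2 * (dist z\<^sub>0 z)\<^sup>2 \<le> r\<^sup>2" by linarith
    then show ?thesis unfolding q using assms by (simp add: divide_le_eq)
  qed
  moreover have "?q z \<le> 0" if "z \<notin> ball z\<^sub>0 r" for z
  proof -
    have "r\<^sup>2 \<le> (dist z\<^sub>0 z)\<^sup>2" using that assms by (intro power_mono) auto
    then show ?thesis unfolding q using assms by (simp add: field_simps)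
  qed
  ultimately show ?thesis using that[of "\<lambda>z. g (?q z)"] g by blast
qed

section \<open>Compactness of closed balls in the model space\<close>

text \<open>Adding a vector \<open>b\<close> to the family gives the image of an interval times the
  previous compact set under the continuous map
  \<open>(t, x) \<mapsto> t *\<^sub>R b + x\<close>.\<close>

lemma compact_bounded_combinations:
  fixes C :: "'e::real_normed_vector set"
  assumes "finite C"
  shows "compact ((\<lambda>c. \<Sum>b\<in>C. c b *\<^sub>R b) ` {c. \<forall>b. \<bar>c b\<bar> \<le> R})"
  using assms
proof induction
  case empty
  have "finite ((\<lambda>c. \<Sum>b\<in>{}. c b *\<^sub>R b) ` {c. \<forall>b::'e. \<bar>c b\<bar> \<le> R})"
    by (rule finite_subset[of _ "{0}"]) auto
  then show ?case by (rule finite_imp_compact)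
next
  case (insert b C)
  let ?K = "\<lambda>C. (\<lambda>c. \<Sum>b\<in>C. c b *\<^sub>R b) ` {c. \<forall>b::'e. \<bar>c b\<bar> \<le> R}"
  have "?K (insert b C) = (\<lambda>(t, x). t *\<^sub>R b + x) ` ({-R..R} \<times> ?K C)"
  proof (intro equalityI subsetI)
    fix x assume "x \<in> ?K (insert b C)"
    then obtain c where c: "x = (\<Sum>b\<in>insert b C. c b *\<^sub>R b)" "\<forall>b. \<bar>c b\<bar> \<le> R" by (elim imageE) simp
    then have "x = (\<lambda>(t, x). t *\<^sub>R b + x) (c b, \<Sum>b\<in>C. c b *\<^sub>R b)" using insert by simp
    moreover have "(c b, \<Sum>b\<in>C. c b *\<^sub>R b) \<in> {-R..R} \<times> ?K C"
      using c(2) by (auto simp: abs_le_iff minus_le_iff)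
    ultimately show "x \<in> (\<lambda>(t, x). t *\<^sub>R b + x) ` ({-R..R} \<times> ?K C)" by (rule image_eqI)
  next
    fix x assume "x \<in> (\<lambda>(t, x). t *\<^sub>R b + x) ` ({-R..R} \<times> ?K C)"
    then obtain t c where x: "t \<in> {-R..R}" "\<forall>b. \<bar>c b\<bar> \<le> R" "x = t *\<^sub>R b + (\<Sum>b\<in>C. c b *\<^sub>R b)"
      by (elim imageE SigmaE) simp
    have "(\<Sum>b\<in>C. c b *\<^sub>R b) = (\<Sum>b'\<in>C. (c(b := t)) b' *\<^sub>R b')"
      using insert by (intro sum.cong) auto
    then have "x = (\<Sum>b'\<in>insert b C. (c(b := t)) b' *\<^sub>R b')" using x insert by simp
    moreover have "c(b := t) \<in> {c. \<forall>b. \<bar>c b\<bar> \<le> R}" using x by auto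
    ultimately show "x \<in> ?K (insert b C)" by (rule image_eqI)
  qed
  moreover have "compact ({-R..R} \<times> ?K C)" by (intro compact_Times insert compact_Icc)
  ultimately show ?case
    unfolding case_prod_unfold by (auto intro!: compact_continuous_image continuous_intros simp del: image_insert)
qed

lemma compact_cball_fin_dim: "compact (cball (z::'e::fin_dim_inner) r)"
proof -
  obtain B :: "'e set" where B: "finite B" "\<forall>x. x = (\<Sum>b\<in>B. (x \<bullet> b) *\<^sub>R b)"
    by (rule finite_orthonormal_expansion)
  \<comment> \<open>By Cauchy-Schwarz this bounds all coefficients \<open>x \<bullet> b\<close> on
    the ball, since the sum of norms dominates each \<open>norm b\<close>. The absolute value of
    \<open>r\<close> keeps the bound nonnegative.\<close>
  define R where "R = (norm z + \<bar>r\<bar>) * (\<Sum>b\<in>B. norm b)"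
  let ?K = "(\<lambda>c. \<Sum>b\<in>B. c b *\<^sub>R b) ` {c. \<forall>b. \<bar>c b\<bar> \<le> R}"
  have "x \<in> ?K" if "x \<in> cball z r" for x
  proof -
    have R0: "R \<ge> 0" unfolding R_def by (intro mult_nonneg_nonneg sum_nonneg) auto
    have "\<bar>x \<bullet> b\<bar> \<le> R" if "b \<in> B" for b
    proof -
      have "norm x \<le> norm z + \<bar>r\<bar>"
        using \<open>x \<in> cball z r\<close> norm_triangle_sub[of x z] by (auto simp: dist_norm norm_minus_commute)
      moreover have "norm b \<le> (\<Sum>b\<in>B. norm b)" using that B(1) by (intro member_le_sum) auto
      ultimately have "norm x * norm b \<le> R" unfolding R_def by (intro mult_mono) auto
      then show ?thesis using Cauchy_Schwarz_ineq2[of x b] by linarith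
    qed
    \<comment> \<open>The bound in \<open>?K\<close> is imposed at every vector, so the coefficients
      are set to 0 outside \<open>B\<close>.\<close>
    then have "(\<lambda>b. if b \<in> B then x \<bullet> b else 0) \<in> {c. \<forall>b. \<bar>c b\<bar> \<le> R}" using R0 by simp
    then show ?thesis
    proof (rule image_eqI[rotated])
      show "x = (\<Sum>b\<in>B. (if b \<in> B then x \<bullet> b else 0) *\<^sub>R b)"
        by (subst B(2)[rule_format]) (auto intro: sum.cong)
    qed
  qed
  then have "?K \<inter> cball z r = cball z r" by blast
  moreover have "compact (?K \<inter> cball z r)"
    by (intro compact_Int_closed compact_bounded_combinations B(1) closed_cball)
  ultimately show ?thesis by simp
qed

section \<open>Smooth functions and tangent vectors on a manifold\<close>

text \<open>The coordinate derivation occurring in \<open>tangent_space\<close>, named so that its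
  dependence on the direction \<open>e\<close> can be studied in one fixed chart.\<close>

definition tvec :: "('a, 'e::real_normed_vector) chart set \<Rightarrow> ('a, 'e) chart \<Rightarrow> 'a \<Rightarrow> 'e \<Rightarrow> 'a tvec" where
  "tvec A c p e = (\<lambda>f. if f \<in> smooth_functions A
     then frechet_derivative (f \<circ> chart_inv c) (at (snd c p)) e else 0)"

locale manifold =
  fixes A :: "('a::{t2_space,second_countable_topology}, 'e::fin_dim_inner) chart set"
  assumes smooth_manifold: "smooth_manifold A"
begin

abbreviation sf :: "('a \<Rightarrow> real) set" where "sf \<equiv> smooth_functions A"
abbreviation d :: "('a \<Rightarrow> real) \<Rightarrow> 'a \<Rightarrow> 'a covec" where "d \<equiv> differential A"

lemma chart_homeomorphism:
  "c \<in> A \<Longrightarrow> homeomorphism (fst c) (snd c ` fst c) (snd c) (chart_inv c)"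
  using smooth_manifold by (auto simp: smooth_manifold_def is_chart_def)

lemma open_chart_domain: "c \<in> A \<Longrightarrow> open (fst c)"
  using smooth_manifold by (auto simp: smooth_manifold_def is_chart_def)

lemma open_chart_range: "c \<in> A \<Longrightarrow> open (snd c ` fst c)"
  using smooth_manifold by (auto simp: smooth_manifold_def is_chart_def)

lemma chart_inv_left: "c \<in> A \<Longrightarrow> p \<in> fst c \<Longrightarrow> chart_inv c (snd c p) = p"
  using homeomorphism_apply1[OF chart_homeomorphism] .

lemma chart_inv_right: "z \<in> snd c ` fst c \<Longrightarrow> snd c (chart_inv c z) = z"
  by (rule f_inv_into_f)

lemma chart_inv_in: "z \<in> snd c ` fst c \<Longrightarrow> chart_inv c z \<in> fst c"
  by (rule inv_into_into)

lemma exists_chart: obtains c where "c \<in> A" "p \<in> fst c"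
proof -
  have "p \<in> (\<Union>c\<in>A. fst c)" using smooth_manifold by (simp add: smooth_manifold_def)
  then show ?thesis using that by blast
qed

lemma smooth_transition:
  "c \<in> A \<Longrightarrow> c' \<in> A \<Longrightarrow> smooth_on (snd c ` (fst c \<inter> fst c')) (\<lambda>z. snd c' (chart_inv c z))"
  using smooth_manifold by (auto simp: smooth_manifold_def comp_def)

lemma chart_image_Int:
  assumes "c \<in> A"
  shows "snd c ` (fst c \<inter> N) = {z \<in> snd c ` fst c. chart_inv c z \<in> N}"
proof (intro equalityI subsetI)
  fix z assume "z \<in> snd c ` (fst c \<inter> N)"
  then show "z \<in> {z \<in> snd c ` fst c. chart_inv c z \<in> N}" using chart_inv_left[OF assms] by auto
next
  fix z assume "z \<in> {z \<in> snd c ` fst c. chart_inv c z \<in> N}"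
  then have "chart_inv c z \<in> fst c \<inter> N" "snd c (chart_inv c z) = z"
    by (auto simp: chart_inv_right chart_inv_in)
  then show "z \<in> snd c ` (fst c \<inter> N)" by (metis imageI)
qed

lemma open_chart_image:
  assumes "c \<in> A" "open N"
  shows "open (snd c ` (fst c \<inter> N))"
proof -
  have "open (chart_inv c -` N \<inter> snd c ` fst c)"
    using continuous_on_open_vimage[OF open_chart_range[OF assms(1)]] assms(2)
      homeomorphism_cont2[OF chart_homeomorphism[OF assms(1)]] by blast
  moreover have "chart_inv c -` N \<inter> snd c ` fst c = snd c ` (fst c \<inter> N)"
    unfolding chart_image_Int[OF assms(1)] by blast
  ultimately show ?thesis by simp
qed

lemma open_chart_preimage:
  assumes "c \<in> A" "open T"
  shows "open {p \<in> fst c. snd c p \<in> T}"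
proof -
  have "open (snd c -` T \<inter> fst c)"
    using continuous_on_open_vimage[OF open_chart_domain[OF assms(1)]] assms(2)
      homeomorphism_cont1[OF chart_homeomorphism[OF assms(1)]] by blast
  moreover have "snd c -` T \<inter> fst c = {p \<in> fst c. snd c p \<in> T}" by blast
  ultimately show ?thesis by simp
qed

lemma smooth_chart_rep: "f \<in> sf \<Longrightarrow> c \<in> A \<Longrightarrow> smooth_on (snd c ` fst c) (\<lambda>z. f (chart_inv c z))"
  by (auto simp: smooth_functions_def comp_def)

text \<open>One chart around \<open>p\<close> suffices as a witness, because smooth transition maps
  carry the property to all other charts.\<close>

definition smooth_at :: "('a \<Rightarrow> real) \<Rightarrow> 'a \<Rightarrow> bool" where
  "smooth_at f p \<longleftrightarrow> (\<exists>c\<in>A. \<exists>T. p \<in> fst c \<and> open T \<and> snd c p \<in> T \<and> T \<subseteq> snd c ` fst c \<and>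
     smooth_on T (\<lambda>z. f (chart_inv c z)))"

lemma smooth_functionsI:
  assumes "\<And>p. smooth_at f p"
  shows "f \<in> sf"
  unfolding smooth_functions_def
proof (intro CollectI ballI smooth_on_local)
  fix c z assume c: "c \<in> A" and z: "z \<in> snd c ` fst c"
  define p where "p = chart_inv c z"
  obtain c' T where c': "c' \<in> A" "p \<in> fst c'" "open T" "snd c' p \<in> T" "T \<subseteq> snd c' ` fst c'"
    "smooth_on T (\<lambda>z. f (chart_inv c' z))"
    using assms[of p] unfolding smooth_at_def by blast
  define N where "N = {q \<in> fst c'. snd c' q \<in> T}"
  \<comment> \<open>The part of the range of \<open>c\<close> that the transition map sends into
    \<open>T\<close>. There the representative in \<open>c\<close> is the one in \<open>c'\<close>
    composed with the transition map.\<close>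
  define S where "S = snd c ` (fst c \<inter> N)"
  have S: "open S" "S \<subseteq> snd c ` (fst c \<inter> fst c')"
    using open_chart_image[OF c] open_chart_preimage[OF c'(1,3)] by (auto simp: S_def N_def)
  have inN: "chart_inv c w \<in> N" if "w \<in> S" for w
    using that chart_image_Int[OF c] by (auto simp: S_def)
  have "smooth_on S (\<lambda>w. f (chart_inv c' (snd c' (chart_inv c w))))"
    using smooth_on_subset[OF smooth_transition[OF c c'(1)] S(2)] inN
    by (intro smooth_on_compose[OF S(1) c'(3) _ _ c'(6)]) (auto simp: N_def)
  then have "smooth_on S (f \<circ> chart_inv c)"
    by (rule smooth_on_cong[OF S(1), rotated]) (use inN chart_inv_left[OF c'(1)] in \<open>auto simp: N_def\<close>)
  moreover have "z \<in> S"
    using z c'(2,4) chart_image_Int[OF c] by (auto simp: S_def N_def p_def)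
  ultimately show "\<exists>S. open S \<and> z \<in> S \<and> smooth_on S (f \<circ> chart_inv c)" using S(1) by blast
qed

lemma smooth_at_locally_eq:
  assumes "g \<in> sf" "open N" "p \<in> N" "\<And>q. q \<in> N \<Longrightarrow> f q = g q"
  shows "smooth_at f p"
proof -
  obtain c where c: "c \<in> A" "p \<in> fst c" by (rule exists_chart)
  let ?T = "snd c ` (fst c \<inter> N)"
  have T: "open ?T" "?T \<subseteq> snd c ` fst c" "snd c p \<in> ?T"
    using open_chart_image[OF c(1) assms(2)] c assms(3) by auto
  have "smooth_on ?T (\<lambda>z. g (chart_inv c z))"
    by (rule smooth_on_subset[OF smooth_chart_rep[OF assms(1) c(1)] T(2)])
  then have "smooth_on ?T (\<lambda>z. f (chart_inv c z))"
    by (rule smooth_on_cong[OF T(1), rotated])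
       (use assms(4) chart_image_Int[OF c(1)] in auto)
  then show ?thesis unfolding smooth_at_def using c T by blast
qed

lemma smooth_functions_const: "(\<lambda>_. r) \<in> sf"
  by (auto simp: smooth_functions_def comp_def intro: smooth_on_const)

lemma smooth_functions_add: "f \<in> sf \<Longrightarrow> g \<in> sf \<Longrightarrow> (\<lambda>p. f p + g p) \<in> sf"
  by (auto simp: smooth_functions_def comp_def intro: smooth_on_add open_chart_range)

lemma smooth_functions_mult: "f \<in> sf \<Longrightarrow> g \<in> sf \<Longrightarrow> (\<lambda>p. f p * g p) \<in> sf"
  by (auto simp: smooth_functions_def comp_def intro: smooth_on_mult open_chart_range)

lemma smooth_functions_sum: "(\<And>i. i \<in> I \<Longrightarrow> f i \<in> sf) \<Longrightarrow> (\<lambda>p. \<Sum>i\<in>I. f i p) \<in> sf"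
  by (induction I rule: infinite_finite_induct)
     (auto intro: smooth_functions_const smooth_functions_add)

section \<open>Extension of functions from a chart by cut-off\<close>

text \<open>A single cut-off serves every coordinate expression \<open>u\<close>, with the same
  neighbourhood \<open>N\<close> on which the extension agrees with \<open>u\<close>. This allows
  families indexed by directions to share one neighbourhood.\<close>

lemma chart_bump:
  assumes c: "c \<in> A" "p \<in> fst c"
  obtains \<psi> N where "open N" "p \<in> N" "N \<subseteq> fst c" "\<forall>q\<in>N. \<psi> q = 1"
    "\<forall>u. smooth_on (snd c ` fst c) u \<longrightarrow> (\<lambda>q. if q \<in> fst c then \<psi> q * u (snd c q) else 0) \<in> sf"
proof -
  define z where "z = snd c p"
  obtain e where e: "e > 0" "ball z e \<subseteq> snd c ` fst c"
    using open_chart_range[OF c(1)] c(2) by (auto simp: open_contains_ball z_def)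
  define r where "r = e / 2"
  have r: "r > 0" "cball z r \<subseteq> snd c ` fst c" using e by (auto simp: r_def)
  obtain \<phi> :: "'e \<Rightarrow> real" where \<phi>: "smooth_on UNIV \<phi>" "\<forall>w\<in>ball z (r / 2). \<phi> w = 1"
    "\<forall>w. w \<notin> ball z r \<longrightarrow> \<phi> w = 0"
    by (rule smooth_bump[OF r(1), of z])
  define \<psi> where "\<psi> = (\<lambda>q. \<phi> (snd c q))"
  define N where "N = {q \<in> fst c. snd c q \<in> ball z (r / 2)}"
  \<comment> \<open>\<open>K\<close> contains all points of the chart domain at which the cut-off is
    nonzero. As a compact subset of a Hausdorff space it is closed, so a point outside the chart
    domain has the open neighbourhood \<open>- K\<close> on which the extension is 0.\<close>
  define K where "K = chart_inv c ` cball z r"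
  have "continuous_on (cball z r) (chart_inv c)"
    using homeomorphism_cont2[OF chart_homeomorphism[OF c(1)]] r(2) continuous_on_subset by blast
  then have "closed K"
    unfolding K_def by (intro compact_imp_closed compact_continuous_image compact_cball_fin_dim)
  then have K: "open (- K)" "K \<subseteq> fst c"
    using r(2) by (auto simp: K_def intro!: chart_inv_in)
  have "(\<lambda>q. if q \<in> fst c then \<psi> q * u (snd c q) else 0) \<in> sf" (is "?f \<in> sf")
    if u: "smooth_on (snd c ` fst c) u" for u
  proof (rule smooth_functionsI)
    fix q
    show "smooth_at ?f q"
    proof (cases "q \<in> fst c")
      case True
      have "smooth_on (snd c ` fst c) (\<lambda>w. \<phi> w * u w)"
        using smooth_on_subset[OF \<phi>(1)] by (intro smooth_on_mult open_chart_range c u) auto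
      then have "smooth_on (snd c ` fst c) (\<lambda>w. ?f (chart_inv c w))"
        by (rule smooth_on_cong[OF open_chart_range[OF c(1)], rotated])
           (auto simp: \<psi>_def chart_inv_left[OF c(1)])
      then show ?thesis unfolding smooth_at_def using True c open_chart_range[OF c(1)] by blast
    next
      case False
      have "?f q' = 0" if "q' \<in> - K" for q'
      proof (cases "q' \<in> fst c")
        case True
        have "snd c q' \<notin> ball z r"
        proof
          assume "snd c q' \<in> ball z r"
          then have "chart_inv c (snd c q') \<in> K" unfolding K_def by (intro imageI) auto
          then show False using that by (simp add: chart_inv_left[OF c(1) True])
        qed
        then show ?thesis by (simp add: \<psi>_def \<phi>(3))
      qed simp
      then show ?thesis
        using False K by (intro smooth_at_locally_eq[OF smooth_functions_const K(1)]) auto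
    qed
  qed
  moreover have "open N" unfolding N_def by (intro open_chart_preimage c open_ball)
  moreover have "p \<in> N" "N \<subseteq> fst c" "\<forall>q\<in>N. \<psi> q = 1"
    using c r(1) \<phi>(2) by (auto simp: N_def \<psi>_def z_def)
  ultimately show ?thesis by (intro that[of N \<psi>]) auto
qed

section \<open>Tangent vectors in coordinates\<close>

lemma has_derivative_chart_rep:
  assumes "f \<in> sf" "c \<in> A" "p \<in> fst c"
  shows "(f \<circ> chart_inv c has_derivative (\<lambda>e. tvec A c p e f)) (at (snd c p))"
  using smooth_on_has_derivative[OF smooth_chart_rep[OF assms(1,2)] imageI[OF assms(3)]] assms(1)
  by (simp add: tvec_def comp_def)

lemma tvec_eqI:
  assumes "f \<in> sf" "(f \<circ> chart_inv c has_derivative D) (at (snd c p))"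
  shows "tvec A c p e f = D e"
  using assms(1) by (simp add: tvec_def frechet_derivative_at[OF assms(2), symmetric])

text \<open>A derivation written in another chart is rewritten in \<open>c\<close> by applying the
  derivative of the transition map to its direction. Hence one chart parametrises the whole tangent
  space and the vector operations can be read off there.\<close>

lemma tangent_space_eq_range:
  assumes c: "c \<in> A" "p \<in> fst c"
  shows "tangent_space A p = range (tvec A c p)"
proof (intro equalityI subsetI)
  fix v assume "v \<in> range (tvec A c p)"
  then show "v \<in> tangent_space A p" using c by (auto simp: tangent_space_def tvec_def)
next
  fix v assume "v \<in> tangent_space A p"
  then obtain c' e where c': "c' \<in> A" "p \<in> fst c'" and v: "v = tvec A c' p e"
    by (auto simp: tangent_space_def tvec_def)
  let ?S = "snd c' ` (fst c' \<inter> fst c)" and ?\<tau> = "\<lambda>z. snd c (chart_inv c' z)"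
  let ?\<tau>' = "frechet_derivative ?\<tau> (at (snd c' p))"
  have S: "open ?S" "snd c' p \<in> ?S"
    using open_chart_image[OF c'(1) open_chart_domain[OF c(1)]] c c' by auto
  have "v = tvec A c p (?\<tau>' e)"
  proof
    fix f
    show "v f = tvec A c p (?\<tau>' e) f"
    proof (cases "f \<in> sf")
      case True
      have "(?\<tau> has_derivative ?\<tau>') (at (snd c' p))"
        by (rule smooth_on_has_derivative[OF smooth_transition S(2)]) (fact c c')+
      moreover have "(f \<circ> chart_inv c has_derivative (\<lambda>e. tvec A c p e f)) (at (?\<tau> (snd c' p)))"
        using has_derivative_chart_rep[OF True c] by (simp add: chart_inv_left c')
      ultimately have "((\<lambda>z. (f \<circ> chart_inv c) (?\<tau> z)) has_derivative (\<lambda>e. tvec A c p (?\<tau>' e) f)) (at (snd c' p))"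
        by (rule has_derivative_compose)
      then have "(f \<circ> chart_inv c' has_derivative (\<lambda>e. tvec A c p (?\<tau>' e) f)) (at (snd c' p))"
        by (rule has_derivative_transform_within_open[OF _ S])
           (auto simp: chart_image_Int[OF c'(1)] chart_inv_left[OF c(1)])
      then show ?thesis unfolding v by (rule tvec_eqI[OF True])
    qed (simp add: v tvec_def)
  qed
  then show "v \<in> range (tvec A c p)" by blast
qed

lemma tvec_in_tangent_space: "c \<in> A \<Longrightarrow> p \<in> fst c \<Longrightarrow> tvec A c p e \<in> tangent_space A p"
  by (simp add: tangent_space_eq_range)

lemma linear_tvec: "f \<in> sf \<Longrightarrow> c \<in> A \<Longrightarrow> p \<in> fst c \<Longrightarrow> linear (\<lambda>e. tvec A c p e f)"
  by (rule bounded_linear.linear[OF has_derivative_bounded_linear[OF has_derivative_chart_rep]])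

lemma tvec_add:
  "c \<in> A \<Longrightarrow> p \<in> fst c \<Longrightarrow> tvec A c p (e + e') = (\<lambda>f. tvec A c p e f + tvec A c p e' f)"
proof
  fix f assume c: "c \<in> A" "p \<in> fst c"
  show "tvec A c p (e + e') f = tvec A c p e f + tvec A c p e' f"
    using linear_add[OF linear_tvec[OF _ c]] by (cases "f \<in> sf") (auto simp: tvec_def)
qed

lemma tvec_scale:
  "c \<in> A \<Longrightarrow> p \<in> fst c \<Longrightarrow> tvec A c p (r *\<^sub>R e) = (\<lambda>f. r * tvec A c p e f)"
proof
  fix f assume c: "c \<in> A" "p \<in> fst c"
  show "tvec A c p (r *\<^sub>R e) f = r * tvec A c p e f"
    using linear_scale[OF linear_tvec[OF _ c]] by (cases "f \<in> sf") (auto simp: tvec_def)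
qed

lemma tangent_space_cases:
  assumes "v \<in> tangent_space A p"
  obtains c e where "c \<in> A" "p \<in> fst c" "v = tvec A c p e"
  using assms by (auto simp: tangent_space_def tvec_def)

lemma tangent_space_add:
  assumes "v \<in> tangent_space A p" "w \<in> tangent_space A p"
  shows "(\<lambda>f. v f + w f) \<in> tangent_space A p"
proof -
  obtain c where c: "c \<in> A" "p \<in> fst c" by (rule exists_chart)
  then show ?thesis using assms tvec_add[OF c, symmetric] by (auto simp: tangent_space_eq_range)
qed

lemma tangent_space_scale:
  assumes "v \<in> tangent_space A p"
  shows "(\<lambda>f. r * v f) \<in> tangent_space A p"
proof -
  obtain c where c: "c \<in> A" "p \<in> fst c" by (rule exists_chart)
  then show ?thesis using assms tvec_scale[OF c, symmetric] by (auto simp: tangent_space_eq_range)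
qed

lemma tangent_space_zero: "(\<lambda>_. 0) \<in> tangent_space A p"
proof -
  obtain c where c: "c \<in> A" "p \<in> fst c" by (rule exists_chart)
  show ?thesis using tangent_space_scale[OF tvec_in_tangent_space[OF c], of 0] by simp
qed

lemma tangent_space_outside: "v \<in> tangent_space A p \<Longrightarrow> f \<notin> sf \<Longrightarrow> v f = 0"
  by (auto elim!: tangent_space_cases simp: tvec_def)

lemma tangent_vector_add:
  assumes "v \<in> tangent_space A p" "f \<in> sf" "g \<in> sf"
  shows "v (\<lambda>x. f x + g x) = v f + v g"
proof -
  obtain c e where c: "c \<in> A" "p \<in> fst c" "v = tvec A c p e" using assms(1) by (rule tangent_space_cases)
  show ?thesis unfolding c(3)
    by (rule tvec_eqI[OF smooth_functions_add[OF assms(2,3)]])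
       (use has_derivative_add[OF has_derivative_chart_rep[OF assms(2) c(1,2)]
          has_derivative_chart_rep[OF assms(3) c(1,2)]] in \<open>simp add: comp_def\<close>)
qed

lemma tangent_vector_mult:
  assumes "v \<in> tangent_space A p" "f \<in> sf" "g \<in> sf"
  shows "v (\<lambda>x. f x * g x) = f p * v g + g p * v f"
proof -
  obtain c e where c: "c \<in> A" "p \<in> fst c" "v = tvec A c p e" using assms(1) by (rule tangent_space_cases)
  have "v (\<lambda>x. f x * g x) = f p * v g + v f * g p" unfolding c(3)
    by (rule tvec_eqI[OF smooth_functions_mult[OF assms(2,3)]])
       (use has_derivative_mult[OF has_derivative_chart_rep[OF assms(2) c(1,2)]
          has_derivative_chart_rep[OF assms(3) c(1,2)]] in \<open>simp add: comp_def chart_inv_left[OF c(1,2)]\<close>)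
  then show ?thesis by simp
qed

lemma tangent_vector_const:
  assumes "v \<in> tangent_space A p"
  shows "v (\<lambda>_. r) = 0"
proof -
  obtain c e where c: "c \<in> A" "p \<in> fst c" "v = tvec A c p e" using assms(1) by (rule tangent_space_cases)
  show ?thesis unfolding c(3)
    by (rule tvec_eqI[OF smooth_functions_const]) (simp add: comp_def)
qed

lemma tangent_vector_scale:
  assumes "v \<in> tangent_space A p" "f \<in> sf"
  shows "v (\<lambda>x. r * f x) = r * v f"
  using tangent_vector_mult[OF assms(1) smooth_functions_const assms(2)] tangent_vector_const[OF assms(1)]
  by simp

lemma tangent_vector_sum:
  assumes "v \<in> tangent_space A p" "\<And>i. i \<in> I \<Longrightarrow> f i \<in> sf"
  shows "v (\<lambda>x. \<Sum>i\<in>I. f i x) = (\<Sum>i\<in>I. v (f i))"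
  using assms(2)
  by (induction I rule: infinite_finite_induct)
     (auto simp: tangent_vector_const[OF assms(1)] tangent_vector_add[OF assms(1)] smooth_functions_sum)

text \<open>Evaluates a derivation on functions that are given by a coordinate expression
  \<open>u\<close> only near \<open>p\<close>, as is the case after a cut-off.\<close>

lemma tvec_local:
  assumes c: "c \<in> A" "p \<in> fst c" and f: "f \<in> sf"
    and N: "open N" "p \<in> N" "\<And>q. q \<in> N \<Longrightarrow> q \<in> fst c \<Longrightarrow> f q = u (snd c q)"
    and u: "(u has_derivative D) (at (snd c p))"
  shows "tvec A c p e f = D e"
proof (rule tvec_eqI[OF f], rule has_derivative_transform_within_open[OF u])
  show "open (snd c ` (fst c \<inter> N))" "snd c p \<in> snd c ` (fst c \<inter> N)"
    using open_chart_image[OF c(1) N(1)] c N by auto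
  show "u z = (f \<circ> chart_inv c) z" if "z \<in> snd c ` (fst c \<inter> N)" for z
    using that N(3) chart_inv_left[OF c(1)] by auto
qed

lemma tangent_vector_cong:
  assumes "v \<in> tangent_space A p" "f \<in> sf" "g \<in> sf" "open N" "p \<in> N" "\<And>q. q \<in> N \<Longrightarrow> f q = g q"
  shows "v f = v g"
proof -
  obtain c e where c: "c \<in> A" "p \<in> fst c" "v = tvec A c p e" using assms(1) by (rule tangent_space_cases)
  show ?thesis unfolding c(3)
    by (rule tvec_local[OF c(1,2) assms(2,4,5) _ has_derivative_chart_rep[OF assms(3) c(1,2)]])
       (auto simp: assms(6) chart_inv_left[OF c(1)])
qed

section \<open>Covectors and local frames\<close>

lemma cotangent_add:
  "a \<in> cotangent_space A p \<Longrightarrow> v \<in> tangent_space A p \<Longrightarrow> w \<in> tangent_space A p \<Longrightarrow>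
    a (\<lambda>f. v f + w f) = a v + a w"
  by (auto simp: cotangent_space_def)

lemma cotangent_scale:
  "a \<in> cotangent_space A p \<Longrightarrow> v \<in> tangent_space A p \<Longrightarrow> a (\<lambda>f. r * v f) = r * a v"
  by (auto simp: cotangent_space_def)

lemma cotangent_zero: "a \<in> cotangent_space A p \<Longrightarrow> a (\<lambda>_. 0) = 0"
  using cotangent_scale[OF _ tangent_space_zero, of a p 0] by simp

lemma cotangent_outside: "a \<in> cotangent_space A p \<Longrightarrow> v \<notin> tangent_space A p \<Longrightarrow> a v = 0"
  by (auto simp: cotangent_space_def)

lemma cotangent_space_zero: "(\<lambda>_. 0) \<in> cotangent_space A p"
  by (simp add: cotangent_space_def)

lemma cotangent_space_add:
  "a \<in> cotangent_space A p \<Longrightarrow> b \<in> cotangent_space A p \<Longrightarrow> (\<lambda>v. a v + b v) \<in> cotangent_space A p"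
  by (simp add: cotangent_space_def algebra_simps)

lemma cotangent_space_scale:
  "a \<in> cotangent_space A p \<Longrightarrow> (\<lambda>v. r * a v) \<in> cotangent_space A p"
  by (simp add: cotangent_space_def algebra_simps)

lemma cotangent_space_sum:
  "(\<And>i. i \<in> I \<Longrightarrow> a i \<in> cotangent_space A p) \<Longrightarrow> (\<lambda>v. \<Sum>i\<in>I. a i v) \<in> cotangent_space A p"
  by (induction I rule: infinite_finite_induct)
     (auto intro: cotangent_space_zero cotangent_space_add)

lemma differential_apply: "v \<in> tangent_space A p \<Longrightarrow> d f p v = v f"
  by (simp add: differential_def)

lemma differential_in_cotangent_space: "d f p \<in> cotangent_space A p"
  by (auto simp: cotangent_space_def differential_def tangent_space_add tangent_space_scale)

lemma differential_in_one_forms: "f \<in> sf \<Longrightarrow> d f \<in> one_forms A"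
  by (auto simp: one_forms_def differential_in_cotangent_space smooth_vector_field_def
      differential_apply)

lemma differential_add:
  "f \<in> sf \<Longrightarrow> g \<in> sf \<Longrightarrow> d (\<lambda>x. f x + g x) p = (\<lambda>v. d f p v + d g p v)"
  by (auto simp: differential_def tangent_vector_add)

lemma differential_mult:
  "f \<in> sf \<Longrightarrow> g \<in> sf \<Longrightarrow> d (\<lambda>x. f x * g x) p = (\<lambda>v. f p * d g p v + g p * d f p v)"
  by (auto simp: differential_def tangent_vector_mult)

lemma differential_scale: "f \<in> sf \<Longrightarrow> d (\<lambda>x. r * f x) p = (\<lambda>v. r * d f p v)"
  by (auto simp: differential_def tangent_vector_scale)

lemma differential_sum:
  "(\<And>i. i \<in> I \<Longrightarrow> f i \<in> sf) \<Longrightarrow> d (\<lambda>x. \<Sum>i\<in>I. f i x) p = (\<lambda>v. \<Sum>i\<in>I. d (f i) p v)"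
  by (auto simp: differential_def tangent_vector_sum)

lemma differential_const: "d (\<lambda>_. r) p = (\<lambda>_. 0)"
  by (auto simp: differential_def tangent_vector_const)

lemma differential_cong:
  assumes "f \<in> sf" "g \<in> sf" "open N" "p \<in> N" "\<And>q. q \<in> N \<Longrightarrow> f q = g q"
  shows "d f p = d g p"
  unfolding differential_def using tangent_vector_cong[OF _ assms] by auto

lemma linear_cotangent_tvec:
  assumes "a \<in> cotangent_space A p" "c \<in> A" "p \<in> fst c"
  shows "linear (\<lambda>e. a (tvec A c p e))"
  using assms
  by (intro linearI) (auto simp: tvec_add tvec_scale cotangent_add cotangent_scale tvec_in_tangent_space)

lemma cotangent_eqI:
  assumes "a \<in> cotangent_space A p" "b \<in> cotangent_space A p" "c \<in> A" "p \<in> fst c"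
    and "\<And>e. a (tvec A c p e) = b (tvec A c p e)"
  shows "a = b"
proof
  fix v
  show "a v = b v"
    using assms(5) tangent_space_eq_range[OF assms(3,4)]
      cotangent_outside[OF assms(1)] cotangent_outside[OF assms(2)]
    by (cases "v \<in> tangent_space A p") auto
qed

section \<open>Global functions and vector fields that are coordinates near a point\<close>

text \<open>The functions are the linear coordinates \<open>z \<bullet> b\<close> of the chart, cut
  off. On \<open>N\<close> the cut-off is identically 1 and does not disturb their
  derivatives.\<close>

lemma chart_coordinates:
  assumes c: "c \<in> A" "p \<in> fst c"
  obtains N x where "open N" "p \<in> N" "N \<subseteq> fst c" "\<forall>b. x b \<in> sf"
    "\<forall>q\<in>N. \<forall>e b. tvec A c q e (x b) = e \<bullet> b"
proof -
  obtain \<psi> N where N: "open N" "p \<in> N" "N \<subseteq> fst c" "\<forall>q\<in>N. \<psi> q = 1"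
    and sm: "\<forall>u. smooth_on (snd c ` fst c) u \<longrightarrow>
      (\<lambda>q. if q \<in> fst c then \<psi> q * u (snd c q) else 0) \<in> sf"
    by (rule chart_bump[OF c])
  define x where "x = (\<lambda>b q. if q \<in> fst c then \<psi> q * (snd c q \<bullet> b) else 0)"
  have x: "x b \<in> sf" for b
    unfolding x_def
    by (intro sm[rule_format] smooth_on_linear bounded_linear_inner_left open_chart_range c)
  have "tvec A c q e (x b) = e \<bullet> b" if "q \<in> N" for q e b
    by (rule tvec_local[OF c(1) _ x N(1) that, where u = "\<lambda>z. z \<bullet> b"])
       (use N that in \<open>auto simp: x_def intro!: bounded_linear_imp_has_derivative bounded_linear_inner_left\<close>)
  then show ?thesis by (intro that[of N x] ballI allI N x) auto
qed

text \<open>By linearity both sides need comparison only on \<open>tvec A c p e\<close>; expanding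
  \<open>e\<close> along \<open>B\<close> and using that \<open>d (x b) p\<close> extracts
  \<open>e \<bullet> b\<close> gives the coefficients.\<close>

lemma covector_coordinates:
  assumes c: "c \<in> A" "p \<in> fst c" and a: "a \<in> cotangent_space A p"
    and B: "\<forall>z. z = (\<Sum>b\<in>B. (z \<bullet> b) *\<^sub>R b)" and x: "\<forall>e b. tvec A c p e (x b) = e \<bullet> b"
  shows "a = (\<lambda>v. \<Sum>b\<in>B. a (tvec A c p b) * d (x b) p v)"
proof (rule cotangent_eqI[OF a _ c])
  show "(\<lambda>v. \<Sum>b\<in>B. a (tvec A c p b) * d (x b) p v) \<in> cotangent_space A p"
    by (intro cotangent_space_sum cotangent_space_scale differential_in_cotangent_space)
  fix e
  note L = linear_cotangent_tvec[OF a c]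
  have "a (tvec A c p e) = (\<Sum>b\<in>B. (e \<bullet> b) * a (tvec A c p b))"
    by (subst B[rule_format]) (simp add: linear_sum[OF L] linear_scale[OF L])
  then show "a (tvec A c p e) = (\<Sum>b\<in>B. a (tvec A c p b) * d (x b) p (tvec A c p e))"
    using x by (simp add: differential_apply tvec_in_tangent_space[OF c] mult.commute)
qed

lemma chart_vector_fields:
  assumes c: "c \<in> A" "p \<in> fst c"
  obtains N E where "open N" "p \<in> N" "N \<subseteq> fst c" "\<forall>e. smooth_vector_field A (E e)"
    "\<forall>q\<in>N. \<forall>e. E e q = tvec A c q e"
proof -
  obtain \<psi> N where N: "open N" "p \<in> N" "N \<subseteq> fst c" "\<forall>q\<in>N. \<psi> q = 1"
    and sm: "\<forall>u. smooth_on (snd c ` fst c) u \<longrightarrow>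
      (\<lambda>q. if q \<in> fst c then \<psi> q * u (snd c q) else 0) \<in> sf"
    by (rule chart_bump[OF c])
  define E where "E = (\<lambda>e q. if q \<in> fst c then (\<lambda>f. \<psi> q * tvec A c q e f) else (\<lambda>_. 0))"
  have "smooth_vector_field A (E e)" for e
    unfolding smooth_vector_field_def
  proof (intro conjI allI ballI)
    show "E e q \<in> tangent_space A q" for q
      using c(1) by (auto simp: E_def tangent_space_zero intro!: tangent_space_scale tvec_in_tangent_space)
  next
    fix f assume f: "f \<in> sf"
    \<comment> \<open>Applied to \<open>f\<close>, the field is the cut-off times a smooth
      coordinate expression, namely the derivative of the representative of
      \<open>f\<close>.\<close>
    have "(\<lambda>q. E e q f) = (\<lambda>q. if q \<in> fst c then
        \<psi> q * frechet_derivative (\<lambda>z. f (chart_inv c z)) (at (snd c q)) e else 0)"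
      using f by (auto simp: E_def tvec_def comp_def)
    also have "\<dots> \<in> sf"
      by (intro sm[rule_format] smooth_on_frechet_derivative smooth_chart_rep f c)
    finally show "(\<lambda>q. E e q f) \<in> sf" .
  qed
  moreover have "E e q = tvec A c q e" if "q \<in> N" for q e
    using that N by (auto simp: E_def)
  ultimately show ?thesis by (intro that[of N E] N) auto
qed

text \<open>Collects what coordinates are needed for. The expansion of covectors holds on a whole
  neighbourhood, so it can be differentiated again, and the fields commute there by the symmetry of
  second derivatives.\<close>

lemma local_frame:
  obtains B :: "'e set" and x :: "'e \<Rightarrow> 'a \<Rightarrow> real" and E :: "'e \<Rightarrow> 'a \<Rightarrow> 'a tvec" and N
  where "finite B" "open N" "p \<in> N" "\<forall>b. x b \<in> sf" "\<forall>b. smooth_vector_field A (E b)"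
    "\<forall>q\<in>N. \<forall>a\<in>cotangent_space A q. a = (\<lambda>v. \<Sum>b\<in>B. a (E b q) * d (x b) q v)"
    "\<forall>q\<in>N. \<forall>f\<in>sf. \<forall>b b'. E b q (\<lambda>r. E b' r f) = E b' q (\<lambda>r. E b r f)"
proof -
  obtain c where c: "c \<in> A" "p \<in> fst c" by (rule exists_chart)
  obtain N1 x where x: "open N1" "p \<in> N1" "N1 \<subseteq> fst c" "\<forall>b. x b \<in> sf"
    "\<forall>q\<in>N1. \<forall>e b. tvec A c q e (x b) = e \<bullet> b"
    by (rule chart_coordinates[OF c])
  obtain N2 E where E: "open N2" "p \<in> N2" "N2 \<subseteq> fst c" "\<forall>e. smooth_vector_field A (E e)"
    "\<forall>q\<in>N2. \<forall>e. E e q = tvec A c q e"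
    by (rule chart_vector_fields[OF c])
  obtain B :: "'e set" where B: "finite B" "\<forall>x. x = (\<Sum>b\<in>B. (x \<bullet> b) *\<^sub>R b)"
    by (rule finite_orthonormal_expansion)
  define N where "N = N1 \<inter> N2"
  have Nc: "N \<subseteq> fst c" using x(3) by (auto simp: N_def)
  have "a = (\<lambda>v. \<Sum>b\<in>B. a (E b q) * d (x b) q v)" if q: "q \<in> N" and a: "a \<in> cotangent_space A q" for q a
    using covector_coordinates[OF c(1) _ a B(2), of x] q Nc x(5) E(5) by (auto simp: N_def)
  moreover have "E b q (\<lambda>r. E b' r f) = E b' q (\<lambda>r. E b r f)" if q: "q \<in> N" and f: "f \<in> sf" for q f b b'
  proof -
    let ?f = "\<lambda>z. f (chart_inv c z)"
    have qc: "q \<in> fst c" using q Nc by blast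
    \<comment> \<open>Near \<open>q\<close> the function \<open>E b' r f\<close> of \<open>r\<close>
      is the directional derivative of the representative of \<open>f\<close>, so a second field
      yields a mixed second derivative.\<close>
    have "tvec A c q b (\<lambda>r. E b' r f) =
        frechet_derivative (\<lambda>z. frechet_derivative ?f (at z) b') (at (snd c q)) b" for b b'
    proof (rule tvec_local[OF c(1) qc _ E(1), where u = "\<lambda>z. frechet_derivative ?f (at z) b'"])
      show "(\<lambda>r. E b' r f) \<in> sf" using E(4) f by (auto simp: smooth_vector_field_def)
      show "q \<in> N2" using q by (simp add: N_def)
      show "E b' r f = frechet_derivative ?f (at (snd c r)) b'" if "r \<in> N2" for r
        using that f by (simp add: E(5) tvec_def comp_def)
      show "((\<lambda>z. frechet_derivative ?f (at z) b') has_derivative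
          frechet_derivative (\<lambda>z. frechet_derivative ?f (at z) b') (at (snd c q))) (at (snd c q))"
        by (rule smooth_on_has_derivative[OF smooth_on_frechet_derivative[OF smooth_chart_rep[OF f c(1)]] imageI[OF qc]])
    qed
    moreover have "E b q = tvec A c q b" for b using q E(5) by (simp add: N_def)
    ultimately show ?thesis
      using frechet_derivative_commute[OF open_chart_range[OF c(1)] smooth_chart_rep[OF f c(1)] imageI[OF qc]]
      by simp
  qed
  moreover have "open N" "p \<in> N" using x E by (auto simp: N_def)
  ultimately show ?thesis by (intro that[of B N x E] B(1) x(4) E(4)) blast+
qed

text \<open>The combination of coordinate functions whose constant coefficients are the components
  of \<open>a\<close>. It realises a covector at one point by a global function, hence also by a
  global one-form.\<close>

lemma covector_is_differential:
  assumes "a \<in> cotangent_space A p"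
  obtains f where "f \<in> sf" "d f p = a"
proof -
  obtain B :: "'e set" and x :: "'e \<Rightarrow> 'a \<Rightarrow> real" and E N where F: "finite B" "p \<in> N" "\<forall>b. x b \<in> sf"
    "\<forall>q\<in>N. \<forall>a\<in>cotangent_space A q. a = (\<lambda>v. \<Sum>b\<in>B. a (E b q) * d (x b) q v)"
    by (rule local_frame[of p])
  let ?f = "\<lambda>q. \<Sum>b\<in>B. a (E b p) * x b q"
  have "?f \<in> sf" using F(3) by (intro smooth_functions_sum smooth_functions_mult smooth_functions_const) auto
  moreover have "d ?f p = (\<lambda>v. \<Sum>b\<in>B. a (E b p) * d (x b) p v)"
    using F(3) by (subst differential_sum)
      (auto simp: differential_scale intro: smooth_functions_mult smooth_functions_const)
  ultimately show ?thesis using that F(4)[rule_format, OF F(2) assms] by simp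
qed

end

section \<open>Brackets of bivector fields\<close>

text \<open>Asks for a bivector field without the Jacobi identity, so that the theory applies to the
  warped field while its Jacobi identity is still the question.\<close>

locale bivector_manifold = manifold A for A :: "('a::{t2_space,second_countable_topology}, 'e::fin_dim_inner) chart set" +
  fixes P :: "'a bivec_field"
  assumes bivector_field: "bivector_field A P"
begin

abbreviation br :: "('a \<Rightarrow> real) \<Rightarrow> ('a \<Rightarrow> real) \<Rightarrow> 'a \<Rightarrow> real" where "br \<equiv> bracket A P"

lemma bivector_at: "bivector_at A p (P p)"
  using bivector_field by (simp add: bivector_field_def)

lemma bivector_add_left:
  "a \<in> cotangent_space A p \<Longrightarrow> b \<in> cotangent_space A p \<Longrightarrow> c \<in> cotangent_space A p \<Longrightarrow>
    P p (\<lambda>v. a v + b v) c = P p a c + P p b c"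
  using bivector_at[of p] unfolding bivector_at_def by blast

lemma bivector_scale_left:
  "a \<in> cotangent_space A p \<Longrightarrow> b \<in> cotangent_space A p \<Longrightarrow> P p (\<lambda>v. r * a v) b = r * P p a b"
  using bivector_at[of p] unfolding bivector_at_def by blast

lemma bivector_antisym:
  "a \<in> cotangent_space A p \<Longrightarrow> b \<in> cotangent_space A p \<Longrightarrow> P p b a = - P p a b"
  using bivector_at[of p] unfolding bivector_at_def by blast

lemma bivector_outside:
  "a \<notin> cotangent_space A p \<or> b \<notin> cotangent_space A p \<Longrightarrow> P p a b = 0"
  using bivector_at[of p] unfolding bivector_at_def by blast

lemma bivector_zero_left: "b \<in> cotangent_space A p \<Longrightarrow> P p (\<lambda>_. 0) b = 0"
  using bivector_scale_left[OF cotangent_space_zero, of b p 0] by simp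

lemma bivector_add_right:
  assumes "a \<in> cotangent_space A p" "b \<in> cotangent_space A p" "c \<in> cotangent_space A p"
  shows "P p c (\<lambda>v. a v + b v) = P p c a + P p c b"
  using bivector_antisym[OF cotangent_space_add[OF assms(1,2)] assms(3)] bivector_add_left[OF assms]
    bivector_antisym[OF assms(1,3)] bivector_antisym[OF assms(2,3)] by simp

lemma bivector_scale_right:
  assumes "a \<in> cotangent_space A p" "b \<in> cotangent_space A p"
  shows "P p b (\<lambda>v. r * a v) = r * P p b a"
  using bivector_antisym[OF cotangent_space_scale[OF assms(1)] assms(2)] bivector_scale_left[OF assms]
    bivector_antisym[OF assms] by simp

lemma bivector_zero_right: "b \<in> cotangent_space A p \<Longrightarrow> P p b (\<lambda>_. 0) = 0"
  using bivector_scale_right[OF cotangent_space_zero, of b p 0] by simp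

lemma bivector_sum_right:
  assumes "b \<in> cotangent_space A p" "\<And>i. i \<in> I \<Longrightarrow> a i \<in> cotangent_space A p"
  shows "P p b (\<lambda>v. \<Sum>i\<in>I. a i v) = (\<Sum>i\<in>I. P p b (a i))"
  using assms(2)
  by (induction I rule: infinite_finite_induct)
     (auto simp: bivector_zero_right[OF assms(1)] bivector_add_right[OF _ _ assms(1)] cotangent_space_sum)

lemma bivector_sum_left:
  assumes "b \<in> cotangent_space A p" "\<And>i. i \<in> I \<Longrightarrow> a i \<in> cotangent_space A p"
  shows "P p (\<lambda>v. \<Sum>i\<in>I. a i v) b = (\<Sum>i\<in>I. P p (a i) b)"
  using assms(2)
  by (induction I rule: infinite_finite_induct)
     (auto simp: bivector_zero_left[OF assms(1)] bivector_add_left[OF _ _ assms(1)] cotangent_space_sum)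

lemma bivector_sum_sum:
  assumes "\<And>i. i \<in> I \<Longrightarrow> a i \<in> cotangent_space A p" "\<And>j. j \<in> J \<Longrightarrow> b j \<in> cotangent_space A p"
  shows "P p (\<lambda>v. \<Sum>i\<in>I. r i * a i v) (\<lambda>v. \<Sum>j\<in>J. s j * b j v) =
    (\<Sum>i\<in>I. \<Sum>j\<in>J. r i * s j * P p (a i) (b j))"
  using assms
  by (simp add: bivector_sum_left bivector_sum_right bivector_scale_left bivector_scale_right
      cotangent_space_scale cotangent_space_sum sum_distrib_left mult.assoc)

lemma bracket_smooth: "f \<in> sf \<Longrightarrow> g \<in> sf \<Longrightarrow> br f g \<in> sf"
  using bivector_field differential_in_one_forms by (auto simp: bivector_field_def bracket_def)

lemma bracket_antisym: "br g f p = - br f g p"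
  unfolding bracket_def by (intro bivector_antisym differential_in_cotangent_space)

text \<open>Antisymmetry between functions, with an explicit factor, so that it can be rewritten
  inside another bracket and moved out by \<open>bracket_scale_right\<close>.\<close>

lemma bracket_antisym_fun: "br g f = (\<lambda>p. (-1) * br f g p)"
  by (intro ext) (simp add: bracket_antisym[of g f])

lemma bracket_add_right:
  "f \<in> sf \<Longrightarrow> g \<in> sf \<Longrightarrow> br h (\<lambda>x. f x + g x) p = br h f p + br h g p"
  by (simp add: bracket_def differential_add bivector_add_right differential_in_cotangent_space)

lemma bracket_add_left:
  "f \<in> sf \<Longrightarrow> g \<in> sf \<Longrightarrow> br (\<lambda>x. f x + g x) h p = br f h p + br g h p"
  by (simp add: bracket_def differential_add bivector_add_left differential_in_cotangent_space)

lemma bracket_scale_right: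
  "f \<in> sf \<Longrightarrow> br h (\<lambda>x. r * f x) p = r * br h f p"
  by (simp add: bracket_def differential_scale bivector_scale_right differential_in_cotangent_space)

lemma bracket_mult_right:
  "f \<in> sf \<Longrightarrow> g \<in> sf \<Longrightarrow> br h (\<lambda>x. f x * g x) p = f p * br h g p + g p * br h f p"
  by (simp add: bracket_def differential_mult bivector_add_right bivector_scale_right
      differential_in_cotangent_space cotangent_space_scale)

lemma bracket_const_right: "br h (\<lambda>_. r) p = 0"
  by (simp add: bracket_def differential_const bivector_zero_right differential_in_cotangent_space)

lemma bracket_const_left: "br (\<lambda>_. r) h p = 0"
  by (simp add: bracket_def differential_const bivector_zero_left differential_in_cotangent_space)

lemma bracket_sum_right:
  "(\<And>i. i \<in> I \<Longrightarrow> f i \<in> sf) \<Longrightarrow> br h (\<lambda>x. \<Sum>i\<in>I. f i x) p = (\<Sum>i\<in>I. br h (f i) p)"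
  by (simp add: bracket_def differential_sum bivector_sum_right differential_in_cotangent_space)

lemma bracket_cong_right:
  "f \<in> sf \<Longrightarrow> g \<in> sf \<Longrightarrow> open N \<Longrightarrow> p \<in> N \<Longrightarrow> (\<And>q. q \<in> N \<Longrightarrow> f q = g q) \<Longrightarrow> br h f p = br h g p"
  by (simp add: bracket_def differential_cong[of f g N p])

section \<open>The Jacobiator and its dependence on differentials\<close>

definition jacobiator :: "('a \<Rightarrow> real) \<Rightarrow> ('a \<Rightarrow> real) \<Rightarrow> ('a \<Rightarrow> real) \<Rightarrow> 'a \<Rightarrow> real" where
  "jacobiator f g h p = br f (br g h) p + br g (br h f) p + br h (br f g) p"

lemma jacobiator_cyclic: "jacobiator f g h p = jacobiator g h f p"
  by (simp add: jacobiator_def)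

text \<open>
  In coordinates, the part of \<open>{h, {g, f}}\<close> that survives when \<open>df\<close> vanishes at \<open>p\<close> is the Hessian
  of \<open>f\<close> evaluated on the Hamiltonian vectors of \<open>g\<close> and \<open>h\<close>, hence symmetric in \<open>g\<close> and \<open>h\<close>.
\<close>

lemma bracket_bracket_commute:
  assumes fgh: "f \<in> sf" "g \<in> sf" "h \<in> sf" and df: "d f p = (\<lambda>_. 0)"
  shows "br h (br g f) p = br g (br h f) p"
proof -
  obtain B :: "'e set" and x :: "'e \<Rightarrow> 'a \<Rightarrow> real" and E N where F:
    "finite B" "open N" "p \<in> N" "\<forall>b. x b \<in> sf" "\<forall>b. smooth_vector_field A (E b)"
    "\<forall>q\<in>N. \<forall>a\<in>cotangent_space A q. a = (\<lambda>v. \<Sum>b\<in>B. a (E b q) * d (x b) q v)"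
    "\<forall>q\<in>N. \<forall>f\<in>sf. \<forall>b b'. E b q (\<lambda>r. E b' r f) = E b' q (\<lambda>r. E b r f)"
    by (rule local_frame[of p])
  have E: "E b q \<in> tangent_space A q" "f \<in> sf \<Longrightarrow> (\<lambda>q. E b q f) \<in> sf" for b q f
    using F(5) by (auto simp: smooth_vector_field_def)
  have x: "x b \<in> sf" for b using F(4) by simp
  \<comment> \<open>Stated on all of \<open>N\<close>, since the outer bracket differentiates the
    expansion of the inner one.\<close>
  have expand: "br g f q = (\<Sum>b\<in>B. E b q f * br g (x b) q)" if "q \<in> N" "f \<in> sf" for q f g
  proof -
    have "d f q = (\<lambda>v. \<Sum>b\<in>B. d f q (E b q) * d (x b) q v)"
      using F(6) that(1) differential_in_cotangent_space by blast
    then have "d f q = (\<lambda>v. \<Sum>b\<in>B. E b q f * d (x b) q v)"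
      by (simp add: differential_apply[OF E(1)])
    then show ?thesis
      by (simp add: bracket_def bivector_sum_right bivector_scale_right
          differential_in_cotangent_space cotangent_space_scale)
  qed
  have E0: "E b p f = 0" for b
    using df differential_apply[OF E(1)[of b p], of f] by simp
  have main: "br h (br g f) p =
      (\<Sum>b\<in>B. \<Sum>b'\<in>B. E b' p (\<lambda>q. E b q f) * br g (x b) p * br h (x b') p)"
    if "g \<in> sf" for g h
  proof -
    have sm: "(\<lambda>q. E b q f * br g (x b) q) \<in> sf" for b
      by (intro smooth_functions_mult E fgh bracket_smooth that x)
    have "br h (br g f) p = br h (\<lambda>q. \<Sum>b\<in>B. E b q f * br g (x b) q) p"
      using expand[OF _ fgh(1)]
      by (intro bracket_cong_right[OF _ _ F(2,3)] bracket_smooth fgh that smooth_functions_sum sm)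
    also have "\<dots> = (\<Sum>b\<in>B. br h (\<lambda>q. E b q f * br g (x b) q) p)"
      by (intro bracket_sum_right sm)
    \<comment> \<open>The other Leibniz term carries the factor \<open>E b p f\<close>, which is 0
      by \<open>E0\<close>. Derivatives of the coefficients \<open>br g (x b)\<close>, and with them
      those of the bivector field, thus drop out.\<close>
    also have "\<dots> = (\<Sum>b\<in>B. br g (x b) p * br h (\<lambda>q. E b q f) p)"
      using that by (simp add: bracket_mult_right E fgh bracket_smooth x E0)
    also have "\<dots> = (\<Sum>b\<in>B. \<Sum>b'\<in>B. E b' p (\<lambda>q. E b q f) * br g (x b) p * br h (x b') p)"
      by (intro sum.cong refl) (simp add: expand[OF F(3) E(2)[OF fgh(1)]] sum_distrib_left mult_ac)
    finally show ?thesis .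
  qed
  have "br h (br g f) p = (\<Sum>b'\<in>B. \<Sum>b\<in>B. E b' p (\<lambda>q. E b q f) * br g (x b) p * br h (x b') p)"
    unfolding main[OF fgh(2)] by (rule sum.swap)
  also have "\<dots> = (\<Sum>b'\<in>B. \<Sum>b\<in>B. E b p (\<lambda>q. E b' q f) * br h (x b') p * br g (x b) p)"
  proof (intro sum.cong refl)
    fix b b'
    have "E b' p (\<lambda>q. E b q f) = E b p (\<lambda>q. E b' q f)" using F(3,7) fgh(1) by blast
    then show "E b' p (\<lambda>q. E b q f) * br g (x b) p * br h (x b') p =
        E b p (\<lambda>q. E b' q f) * br h (x b') p * br g (x b) p" by simp
  qed
  also have "\<dots> = br g (br h f) p"
    unfolding main[OF fgh(3)] by (rule refl)
  finally show ?thesis .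
qed

text \<open>The term with \<open>f\<close> outermost vanishes with \<open>d f p\<close>; the two
  remaining ones are the nested brackets of \<open>bracket_bracket_commute\<close> with opposite
  signs.\<close>

lemma jacobiator_eq_0:
  assumes "f \<in> sf" "g \<in> sf" "h \<in> sf" "d f p = (\<lambda>_. 0)"
  shows "jacobiator f g h p = 0"
proof -
  have "br f (br g h) p = 0"
    using assms(4) by (simp add: bracket_def bivector_zero_left differential_in_cotangent_space)
  moreover have "br h (br f g) p = - br h (br g f) p"
    unfolding bracket_antisym_fun[of f g] using bracket_scale_right[OF bracket_smooth, of g f h "-1"] assms
    by simp
  ultimately show ?thesis
    using bracket_bracket_commute[OF assms] by (simp add: jacobiator_def)
qed

lemma jacobiator_add:
  assumes "f \<in> sf" "f' \<in> sf" "g \<in> sf" "h \<in> sf"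
  shows "jacobiator (\<lambda>x. f x + f' x) g h p = jacobiator f g h p + jacobiator f' g h p"
proof -
  have "br h (\<lambda>x. f x + f' x) = (\<lambda>q. br h f q + br h f' q)"
    "br (\<lambda>x. f x + f' x) g = (\<lambda>q. br f g q + br f' g q)"
    using assms by (auto simp: bracket_add_right bracket_add_left)
  then show ?thesis
    using assms by (simp add: jacobiator_def bracket_add_left bracket_add_right bracket_smooth)
qed

text \<open>Additivity reduces this to the difference \<open>f - f'\<close>, whose differential
  vanishes at \<open>p\<close>. By cyclicity it serves for every argument.\<close>

lemma jacobiator_cong:
  assumes "f \<in> sf" "f' \<in> sf" "g \<in> sf" "h \<in> sf" "d f p = d f' p"
  shows "jacobiator f g h p = jacobiator f' g h p"
proof -
  have sm: "(\<lambda>x. (-1) * f' x) \<in> sf" "(\<lambda>x. f x + (-1) * f' x) \<in> sf"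
    by (intro smooth_functions_add smooth_functions_mult smooth_functions_const assms)+
  have "d (\<lambda>x. f x + (-1) * f' x) p = (\<lambda>_. 0)"
    using differential_add[OF assms(1) sm(1), of p] differential_scale[OF assms(2), of "-1" p] assms(5)
    by simp
  then have "jacobiator (\<lambda>x. f x + (-1) * f' x) g h p = 0"
    by (intro jacobiator_eq_0 sm assms)
  moreover have "jacobiator f g h p =
      jacobiator (\<lambda>x. f x + (-1) * f' x) g h p + jacobiator f' g h p"
    using jacobiator_add[OF sm(2) assms(2-4), of p] by simp
  ultimately show ?thesis by simp
qed

lemma poisson_tensor_iff:
  "poisson_tensor A P \<longleftrightarrow> (\<forall>f\<in>sf. \<forall>g\<in>sf. \<forall>h\<in>sf. \<forall>p. jacobiator f g h p = 0)"
  using bivector_field by (simp add: poisson_tensor_def jacobiator_def)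

section \<open>Hamiltonian vectors and Casimir functions\<close>

text \<open>The vector has the components \<open>P p (d f p) (d (x b) p)\<close> in the coordinate
  fields. Its existence is the finite-dimensional identification of functionals on covectors with
  tangent vectors, required by the description in \<open>anchor\<close>.\<close>

lemma hamiltonian_vector:
  obtains v where "v \<in> tangent_space A p" "\<forall>b\<in>cotangent_space A p. b v = P p (d f p) b"
proof -
  obtain B :: "'e set" and x :: "'e \<Rightarrow> 'a \<Rightarrow> real" and E N where F:
    "finite B" "open N" "p \<in> N" "\<forall>b. x b \<in> sf" "\<forall>b. smooth_vector_field A (E b)"
    "\<forall>q\<in>N. \<forall>a\<in>cotangent_space A q. a = (\<lambda>v. \<Sum>b\<in>B. a (E b q) * d (x b) q v)"
    "\<forall>q\<in>N. \<forall>f\<in>sf. \<forall>b b'. E b q (\<lambda>r. E b' r f) = E b' q (\<lambda>r. E b r f)"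
    by (rule local_frame[of p])
  have E: "E b p \<in> tangent_space A p" for b using F(5) by (auto simp: smooth_vector_field_def)
  let ?v = "\<lambda>C g. \<Sum>b\<in>C. P p (d f p) (d (x b) p) * E b p g"
  \<comment> \<open>Proved for all index sets at once: evaluating a covector on a sum uses that the
    partial sums are tangent vectors, so both claims share the induction.\<close>
  have v: "?v C \<in> tangent_space A p \<and>
      (\<forall>a\<in>cotangent_space A p. a (?v C) = (\<Sum>b\<in>C. P p (d f p) (d (x b) p) * a (E b p)))" for C
  proof (induction C rule: infinite_finite_induct)
    case (insert b C)
    then have vC: "?v C \<in> tangent_space A p" by blast
    let ?w = "\<lambda>g. P p (d f p) (d (x b) p) * E b p g"
    have w: "?w \<in> tangent_space A p" by (intro tangent_space_scale E)
    have "?v (insert b C) = (\<lambda>g. ?w g + ?v C g)" using insert by simp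
    then show ?case
      using insert tangent_space_add[OF w vC] cotangent_add[OF _ w vC] cotangent_scale[OF _ E] by simp
  qed (simp_all add: tangent_space_zero cotangent_zero)
  have "a (?v B) = P p (d f p) a" if a: "a \<in> cotangent_space A p" for a
  proof -
    have "a = (\<lambda>v. \<Sum>b\<in>B. a (E b p) * d (x b) p v)" using F(3,6) a by blast
    then have "P p (d f p) a = P p (d f p) (\<lambda>v. \<Sum>b\<in>B. a (E b p) * d (x b) p v)"
      by (rule arg_cong)
    also have "\<dots> = (\<Sum>b\<in>B. a (E b p) * P p (d f p) (d (x b) p))"
      by (simp add: bivector_sum_right bivector_scale_right
          differential_in_cotangent_space cotangent_space_scale)
    finally show ?thesis using v[of B] a by (simp add: mult.commute)
  qed
  then show ?thesis using v[of B] that by blast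
qed

lemma hamiltonian_vector_field_spec:
  "hamiltonian_vector_field A P f p \<in> tangent_space A p \<and>
    (\<forall>b\<in>cotangent_space A p. b (hamiltonian_vector_field A P f p) = P p (d f p) b)"
proof -
  obtain v where v: "v \<in> tangent_space A p" "\<forall>b\<in>cotangent_space A p. b v = P p (d f p) b"
    by (rule hamiltonian_vector)
  show ?thesis
    unfolding hamiltonian_vector_field_def anchor_def
  proof (rule theI[where P = "\<lambda>v. v \<in> tangent_space A p \<and> (\<forall>b\<in>cotangent_space A p. b v = P p (d f p) b)"])
    show "v \<in> tangent_space A p \<and> (\<forall>b\<in>cotangent_space A p. b v = P p (d f p) b)" using v by blast
  next
    fix w assume w: "w \<in> tangent_space A p \<and> (\<forall>b\<in>cotangent_space A p. b w = P p (d f p) b)"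
    \<comment> \<open>Differentials of smooth functions separate tangent vectors, and on functions
      that are not smooth all tangent vectors are 0.\<close>
    show "w = v"
    proof
      fix g
      show "w g = v g"
      proof (cases "g \<in> sf")
        case True
        have "d g p w = d g p v" using v(2) w differential_in_cotangent_space[of g p] by metis
        then show ?thesis using w by (simp add: differential_apply v(1))
      qed (use w in \<open>simp add: tangent_space_outside[OF v(1)] tangent_space_outside[of w p]\<close>)
    qed
  qed
qed

lemma hamiltonian_vector_field_apply: "hamiltonian_vector_field A P f p g = (if g \<in> sf then br f g p else 0)"
proof (cases "g \<in> sf")
  case True
  have "hamiltonian_vector_field A P f p g = d g p (hamiltonian_vector_field A P f p)"
    using hamiltonian_vector_field_spec by (simp add: differential_apply)
  also have "\<dots> = br f g p"
    using hamiltonian_vector_field_spec differential_in_cotangent_space by (simp add: bracket_def)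
  finally show ?thesis using True by simp
qed (simp add: tangent_space_outside[OF conjunct1[OF hamiltonian_vector_field_spec]])

lemma casimir_iff: "casimir A P f \<longleftrightarrow> f \<in> sf \<and> (\<forall>g\<in>sf. \<forall>p. br f g p = 0)"
  by (auto simp: casimir_def fun_eq_iff hamiltonian_vector_field_apply)

end

section \<open>Product manifolds\<close>

abbreviation prod_chart :: "('a, 'e) chart \<Rightarrow> ('b, 'f) chart \<Rightarrow> ('a \<times> 'b, 'e \<times> 'f) chart" where
  "prod_chart c c' \<equiv> (fst c \<times> fst c', map_prod (snd c) (snd c'))"

locale product_manifold = M1: manifold A1 + M2: manifold A2
  for A1 :: "('a::{t2_space,second_countable_topology}, 'e::fin_dim_inner) chart set"
    and A2 :: "('b::{t2_space,second_countable_topology}, 'f::fin_dim_inner) chart set"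
begin

lemma image_map_prod_Times: "map_prod x y ` (U \<times> V) = (x ` U) \<times> (y ` V)"
  by force

text \<open>\<open>inv_into\<close> is a choice; on the product of the ranges injectivity forces it
  to be the pair of inverses.\<close>

lemma prod_chart_inv:
  assumes "c \<in> A1" "c' \<in> A2" "z \<in> snd c ` fst c" "w \<in> snd c' ` fst c'"
  shows "inv_into (fst c \<times> fst c') (map_prod (snd c) (snd c')) (z, w) = (chart_inv c z, chart_inv c' w)"
proof (rule inv_into_f_eq)
  have "inj_on (snd c) (fst c)" "inj_on (snd c') (fst c')"
    using M1.chart_inv_left[OF assms(1)] M2.chart_inv_left[OF assms(2)] by (metis inj_onI)+
  then show "inj_on (map_prod (snd c) (snd c')) (fst c \<times> fst c')"
    by (auto simp: inj_on_def)
qed (use assms in \<open>auto simp: M1.chart_inv_in M2.chart_inv_in M1.chart_inv_right M2.chart_inv_right\<close>)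

lemma prod_chart_is_chart:
  assumes "c \<in> A1" "c' \<in> A2"
  shows "is_chart (prod_chart c c')"
proof -
  note h1 = M1.chart_homeomorphism[OF assms(1)] and h2 = M2.chart_homeomorphism[OF assms(2)]
  have inv: "chart_inv (prod_chart c c') z = map_prod (chart_inv c) (chart_inv c') z"
    if "z \<in> snd c ` fst c \<times> snd c' ` fst c'" for z
    using that prod_chart_inv[OF assms] by auto
  have cont: "continuous_on (S \<times> T) (map_prod f g)" if "continuous_on S f" "continuous_on T g"
    for S T and f :: "'p::topological_space \<Rightarrow> 'q::topological_space" and g :: "'r::topological_space \<Rightarrow> 's::topological_space"
    unfolding map_prod_def case_prod_unfold
    by (intro continuous_on_Pair continuous_on_compose2[OF that(1)] continuous_on_compose2[OF that(2)])
       (auto intro!: continuous_intros)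
  have "homeomorphism (fst c \<times> fst c') (snd c ` fst c \<times> snd c' ` fst c')
      (map_prod (snd c) (snd c')) (chart_inv (prod_chart c c'))"
  proof (rule homeomorphismI)
    show "continuous_on (fst c \<times> fst c') (map_prod (snd c) (snd c'))"
      by (intro cont homeomorphism_cont1[OF h1] homeomorphism_cont1[OF h2])
    have "continuous_on (snd c ` fst c \<times> snd c' ` fst c') (map_prod (chart_inv c) (chart_inv c'))"
      by (intro cont homeomorphism_cont2[OF h1] homeomorphism_cont2[OF h2])
    then show "continuous_on (snd c ` fst c \<times> snd c' ` fst c') (chart_inv (prod_chart c c'))"
      using inv by (simp cong: continuous_on_cong)
  qed (auto simp: prod_chart_inv[OF assms] M1.chart_inv_left[OF assms(1)] M2.chart_inv_left[OF assms(2)]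
         M1.chart_inv_in M2.chart_inv_in M1.chart_inv_right M2.chart_inv_right)
  then show ?thesis
    unfolding is_chart_def fst_conv snd_conv image_map_prod_Times
    by (intro conjI open_Times M1.open_chart_domain M2.open_chart_domain
        M1.open_chart_range M2.open_chart_range assms)
qed

lemma smooth_prod_transition:
  assumes "c \<in> A1" "c' \<in> A2" "e \<in> A1" "e' \<in> A2"
  shows "smooth_on (snd (prod_chart c c') ` (fst (prod_chart c c') \<inter> fst (prod_chart e e')))
    (snd (prod_chart e e') \<circ> chart_inv (prod_chart c c'))"
proof -
  let ?S = "snd c ` (fst c \<inter> fst e)" and ?S' = "snd c' ` (fst c' \<inter> fst e')"
  have S: "open ?S" "open ?S'"
    by (intro M1.open_chart_image M2.open_chart_image M1.open_chart_domain M2.open_chart_domain assms)+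
  have S_eq: "snd (prod_chart c c') ` (fst (prod_chart c c') \<inter> fst (prod_chart e e')) = ?S \<times> ?S'"
    by (simp add: Times_Int_Times image_map_prod_Times)
  have ST: "open (?S \<times> ?S')" by (intro open_Times S)
  have "smooth_on (?S \<times> ?S') (\<lambda>z. snd e (chart_inv c (fst z)))"
    by (intro smooth_on_compose[OF ST S(1) _ _ M1.smooth_transition] smooth_on_linear bounded_linear_fst ST assms)
       auto
  moreover have "smooth_on (?S \<times> ?S') (\<lambda>z. snd e' (chart_inv c' (snd z)))"
    by (intro smooth_on_compose[OF ST S(2) _ _ M2.smooth_transition] smooth_on_linear bounded_linear_snd ST assms)
       auto
  ultimately have "smooth_on (?S \<times> ?S') (\<lambda>z. (snd e (chart_inv c (fst z)), snd e' (chart_inv c' (snd z))))"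
    by (intro smooth_on_Pair ST)
  then show ?thesis
    unfolding S_eq by (rule smooth_on_cong[OF ST, rotated]) (auto simp: prod_chart_inv assms)
qed

lemma prod_chart_in_atlas: "c \<in> A1 \<Longrightarrow> c' \<in> A2 \<Longrightarrow> prod_chart c c' \<in> prod_atlas A1 A2"
  unfolding prod_atlas_def by (intro CollectI exI[of _ c] exI[of _ c'] conjI refl)

lemma prod_atlas_cases:
  assumes "C \<in> prod_atlas A1 A2"
  obtains c c' where "c \<in> A1" "c' \<in> A2" "C = prod_chart c c'"
  using assms unfolding prod_atlas_def mem_Collect_eq by (elim exE conjE) (rule that)

lemma smooth_manifold_prod: "smooth_manifold (prod_atlas A1 A2)"
  unfolding smooth_manifold_def
proof (intro conjI ballI)
  show "is_chart C" if "C \<in> prod_atlas A1 A2" for C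
    using that by (elim prod_atlas_cases) (simp only: prod_chart_is_chart)
  show "smooth_on (snd C ` (fst C \<inter> fst C')) (snd C' \<circ> chart_inv C)"
    if "C \<in> prod_atlas A1 A2" "C' \<in> prod_atlas A1 A2" for C C'
    using that by (elim prod_atlas_cases) (simp only: smooth_prod_transition)
  have "(p, q) \<in> (\<Union>C\<in>prod_atlas A1 A2. fst C)" for p q
  proof -
    obtain c where "c \<in> A1" "p \<in> fst c" by (rule M1.exists_chart)
    moreover obtain c' where "c' \<in> A2" "q \<in> fst c'" by (rule M2.exists_chart)
    ultimately show ?thesis by (intro UN_I[OF prod_chart_in_atlas]) auto
  qed
  then show "(\<Union>C\<in>prod_atlas A1 A2. fst C) = UNIV" by auto
qed

sublocale M: manifold "prod_atlas A1 A2"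
  by unfold_locales (rule smooth_manifold_prod)

section \<open>Lifts and slices of smooth functions\<close>

lemma smooth_lift_fst:
  assumes "f \<in> M1.sf"
  shows "(\<lambda>z. f (fst z)) \<in> M.sf"
  unfolding smooth_functions_def
proof (intro CollectI ballI)
  fix C assume "C \<in> prod_atlas A1 A2"
  then obtain c c' where c: "c \<in> A1" "c' \<in> A2" "C = prod_chart c c'" by (rule prod_atlas_cases)
  let ?S = "snd c ` fst c" and ?S' = "snd c' ` fst c'"
  have S: "open ?S" "open (?S \<times> ?S')"
    by (intro M1.open_chart_range M2.open_chart_range open_Times c)+
  have "smooth_on (?S \<times> ?S') (\<lambda>z. f (chart_inv c (fst z)))"
    by (intro smooth_on_compose[OF S(2,1) _ _ M1.smooth_chart_rep[OF assms c(1)]] smooth_on_linear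
        bounded_linear_fst S) auto
  then show "smooth_on (snd C ` fst C) ((\<lambda>z. f (fst z)) \<circ> chart_inv C)"
    unfolding c(3) fst_conv snd_conv image_map_prod_Times
    by (rule smooth_on_cong[OF S(2), rotated]) (auto simp: prod_chart_inv c)
qed

lemma smooth_lift_snd:
  assumes "f \<in> M2.sf"
  shows "(\<lambda>z. f (snd z)) \<in> M.sf"
  unfolding smooth_functions_def
proof (intro CollectI ballI)
  fix C assume "C \<in> prod_atlas A1 A2"
  then obtain c c' where c: "c \<in> A1" "c' \<in> A2" "C = prod_chart c c'" by (rule prod_atlas_cases)
  let ?S = "snd c ` fst c" and ?S' = "snd c' ` fst c'"
  have S: "open ?S'" "open (?S \<times> ?S')"
    by (intro M1.open_chart_range M2.open_chart_range open_Times c)+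
  have "smooth_on (?S \<times> ?S') (\<lambda>z. f (chart_inv c' (snd z)))"
    by (intro smooth_on_compose[OF S(2,1) _ _ M2.smooth_chart_rep[OF assms c(2)]] smooth_on_linear
        bounded_linear_snd S) auto
  then show "smooth_on (snd C ` fst C) ((\<lambda>z. f (snd z)) \<circ> chart_inv C)"
    unfolding c(3) fst_conv snd_conv image_map_prod_Times
    by (rule smooth_on_cong[OF S(2), rotated]) (auto simp: prod_chart_inv c)
qed

lemma smooth_slice_fst:
  assumes "F \<in> M.sf"
  shows "(\<lambda>p. F (p, q)) \<in> M1.sf"
  unfolding smooth_functions_def
proof (intro CollectI ballI)
  fix c assume c: "c \<in> A1"
  obtain c' where c': "c' \<in> A2" "q \<in> fst c'" by (rule M2.exists_chart)
  let ?C = "prod_chart c c'"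
  note C = prod_chart_in_atlas[OF c c'(1)]
  \<comment> \<open>In coordinates, freezing the second argument is composition with the affine
    inclusion at the coordinate value of \<open>q\<close>.\<close>
  have "smooth_on (snd c ` fst c) (\<lambda>z. F (chart_inv ?C (z, snd c' q)))"
    by (rule smooth_on_compose[OF _ M.open_chart_range[OF C] _ _ M.smooth_chart_rep[OF assms C]])
       (auto simp: image_map_prod_Times c' intro!: M1.open_chart_range c smooth_on_Pair smooth_on_id smooth_on_const)
  then show "smooth_on (snd c ` fst c) ((\<lambda>p. F (p, q)) \<circ> chart_inv c)"
    by (rule smooth_on_cong[OF M1.open_chart_range[OF c], rotated])
       (auto simp: prod_chart_inv c c' M2.chart_inv_left)
qed

lemma smooth_slice_snd:
  assumes "F \<in> M.sf"
  shows "(\<lambda>q. F (p, q)) \<in> M2.sf"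
  unfolding smooth_functions_def
proof (intro CollectI ballI)
  fix c' assume c': "c' \<in> A2"
  obtain c where c: "c \<in> A1" "p \<in> fst c" by (rule M1.exists_chart)
  let ?C = "prod_chart c c'"
  note C = prod_chart_in_atlas[OF c(1) c']
  have "smooth_on (snd c' ` fst c') (\<lambda>z. F (chart_inv ?C (snd c p, z)))"
    by (rule smooth_on_compose[OF _ M.open_chart_range[OF C] _ _ M.smooth_chart_rep[OF assms C]])
       (auto simp: image_map_prod_Times c intro!: M2.open_chart_range c' smooth_on_Pair smooth_on_id smooth_on_const)
  then show "smooth_on (snd c' ` fst c') ((\<lambda>q. F (p, q)) \<circ> chart_inv c')"
    by (rule smooth_on_cong[OF M2.open_chart_range[OF c'], rotated])
       (auto simp: prod_chart_inv c c' M1.chart_inv_left)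
qed

section \<open>Tangent vectors of the product\<close>

abbreviation "\<iota>1 q \<equiv> push_forward (prod_atlas A1 A2) (\<lambda>p. (p, q))"
abbreviation "\<iota>2 p \<equiv> push_forward (prod_atlas A1 A2) (\<lambda>q. (p, q))"
abbreviation "\<pi>1 \<equiv> push_forward A1 fst"
abbreviation "\<pi>2 \<equiv> push_forward A2 snd"

context
  fixes c c' p q
  assumes c: "c \<in> A1" "c' \<in> A2" "p \<in> fst c" "q \<in> fst c'"
begin

text \<open>The chain rule for the slice inclusion, which in coordinates is
  \<open>z \<mapsto> (z, snd c' q)\<close> and has derivative
  \<open>e \<mapsto> (e, 0)\<close>.\<close>

lemma \<iota>1_tvec: "\<iota>1 q (tvec A1 c p e) = tvec (prod_atlas A1 A2) (prod_chart c c') (p, q) (e, 0)"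
proof
  fix F
  let ?C = "prod_chart c c'"
  note C = prod_chart_in_atlas[OF c(1,2)]
  show "\<iota>1 q (tvec A1 c p e) F = tvec (prod_atlas A1 A2) ?C (p, q) (e, 0) F"
  proof (cases "F \<in> M.sf")
    case True
    have "((\<lambda>z. (z, snd c' q)) has_derivative (\<lambda>e. (e, 0))) (at (snd c p))"
      by (intro has_derivative_Pair has_derivative_ident has_derivative_const)
    moreover have "(F \<circ> chart_inv ?C has_derivative (\<lambda>e. tvec (prod_atlas A1 A2) ?C (p, q) e F))
        (at (snd c p, snd c' q))"
      using M.has_derivative_chart_rep[OF True C, of "(p, q)"] c by simp
    ultimately have "((\<lambda>z. (F \<circ> chart_inv ?C) (z, snd c' q)) has_derivative
        (\<lambda>e. tvec (prod_atlas A1 A2) ?C (p, q) (e, 0) F)) (at (snd c p))"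
      by (rule has_derivative_compose)
    then have "((\<lambda>p. F (p, q)) \<circ> chart_inv c has_derivative
        (\<lambda>e. tvec (prod_atlas A1 A2) ?C (p, q) (e, 0) F)) (at (snd c p))"
      by (rule has_derivative_transform_within_open[OF _ M1.open_chart_range[OF c(1)]])
         (use c in \<open>auto simp: prod_chart_inv M2.chart_inv_left\<close>)
    from M1.tvec_eqI[OF smooth_slice_fst[OF True] this] show ?thesis
      using True by (simp add: push_forward_def comp_def)
  qed (simp add: push_forward_def tvec_def)
qed

lemma \<iota>2_tvec: "\<iota>2 p (tvec A2 c' q e) = tvec (prod_atlas A1 A2) (prod_chart c c') (p, q) (0, e)"
proof
  fix F
  let ?C = "prod_chart c c'"
  note C = prod_chart_in_atlas[OF c(1,2)]
  show "\<iota>2 p (tvec A2 c' q e) F = tvec (prod_atlas A1 A2) ?C (p, q) (0, e) F"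
  proof (cases "F \<in> M.sf")
    case True
    have "((\<lambda>z. (snd c p, z)) has_derivative (\<lambda>e. (0, e))) (at (snd c' q))"
      by (intro has_derivative_Pair has_derivative_ident has_derivative_const)
    moreover have "(F \<circ> chart_inv ?C has_derivative (\<lambda>e. tvec (prod_atlas A1 A2) ?C (p, q) e F))
        (at (snd c p, snd c' q))"
      using M.has_derivative_chart_rep[OF True C, of "(p, q)"] c by simp
    ultimately have "((\<lambda>z. (F \<circ> chart_inv ?C) (snd c p, z)) has_derivative
        (\<lambda>e. tvec (prod_atlas A1 A2) ?C (p, q) (0, e) F)) (at (snd c' q))"
      by (rule has_derivative_compose)
    then have "((\<lambda>q. F (p, q)) \<circ> chart_inv c' has_derivative
        (\<lambda>e. tvec (prod_atlas A1 A2) ?C (p, q) (0, e) F)) (at (snd c' q))"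
      by (rule has_derivative_transform_within_open[OF _ M2.open_chart_range[OF c(2)]])
         (use c in \<open>auto simp: prod_chart_inv M1.chart_inv_left\<close>)
    from M2.tvec_eqI[OF smooth_slice_snd[OF True] this] show ?thesis
      using True by (simp add: push_forward_def comp_def)
  qed (simp add: push_forward_def tvec_def)
qed

lemma \<pi>1_tvec: "\<pi>1 (tvec (prod_atlas A1 A2) (prod_chart c c') (p, q) e) = tvec A1 c p (fst e)"
proof
  fix f
  note C = prod_chart_in_atlas[OF c(1,2)]
  show "\<pi>1 (tvec (prod_atlas A1 A2) (prod_chart c c') (p, q) e) f = tvec A1 c p (fst e) f"
  proof (cases "f \<in> M1.sf")
    case True
    have "tvec (prod_atlas A1 A2) (prod_chart c c') (p, q) e (\<lambda>z. f (fst z)) = tvec A1 c p (fst e) f"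
    proof (rule M.tvec_local[OF C _ smooth_lift_fst[OF True] open_UNIV])
      show "((\<lambda>z. (f \<circ> chart_inv c) (fst z)) has_derivative (\<lambda>e. tvec A1 c p (fst e) f))
          (at (snd (prod_chart c c') (p, q)))"
        using M1.has_derivative_chart_rep[OF True c(1,3)]
        by (intro has_derivative_compose[OF has_derivative_fst[OF has_derivative_ident]]) (simp add: comp_def)
    qed (use c in \<open>auto simp: M1.chart_inv_left\<close>)
    then show ?thesis using True by (simp add: push_forward_def comp_def)
  qed (simp add: push_forward_def tvec_def)
qed

lemma \<pi>2_tvec: "\<pi>2 (tvec (prod_atlas A1 A2) (prod_chart c c') (p, q) e) = tvec A2 c' q (snd e)"
proof
  fix f
  note C = prod_chart_in_atlas[OF c(1,2)]
  show "\<pi>2 (tvec (prod_atlas A1 A2) (prod_chart c c') (p, q) e) f = tvec A2 c' q (snd e) f"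
  proof (cases "f \<in> M2.sf")
    case True
    have "tvec (prod_atlas A1 A2) (prod_chart c c') (p, q) e (\<lambda>z. f (snd z)) = tvec A2 c' q (snd e) f"
    proof (rule M.tvec_local[OF C _ smooth_lift_snd[OF True] open_UNIV])
      show "((\<lambda>z. (f \<circ> chart_inv c') (snd z)) has_derivative (\<lambda>e. tvec A2 c' q (snd e) f))
          (at (snd (prod_chart c c') (p, q)))"
        using M2.has_derivative_chart_rep[OF True c(2,4)]
        by (intro has_derivative_compose[OF has_derivative_snd[OF has_derivative_ident]]) (simp add: comp_def)
    qed (use c in \<open>auto simp: M2.chart_inv_left\<close>)
    then show ?thesis using True by (simp add: push_forward_def comp_def)
  qed (simp add: push_forward_def tvec_def)
qed

end

lemma push_forward_add:
  "push_forward B F (\<lambda>f. v f + w f) = (\<lambda>f. push_forward B F v f + push_forward B F w f)"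
  by (auto simp: push_forward_def)

lemma push_forward_scale:
  "push_forward B F (\<lambda>f. r * v f) = (\<lambda>f. r * push_forward B F v f)"
  by (auto simp: push_forward_def)

lemma prod_tangent_space_cases:
  assumes "v \<in> tangent_space (prod_atlas A1 A2) (p, q)"
  obtains c c' e where "c \<in> A1" "c' \<in> A2" "p \<in> fst c" "q \<in> fst c'"
    "v = tvec (prod_atlas A1 A2) (prod_chart c c') (p, q) e"
proof -
  obtain c where c: "c \<in> A1" "p \<in> fst c" by (rule M1.exists_chart)
  obtain c' where c': "c' \<in> A2" "q \<in> fst c'" by (rule M2.exists_chart)
  have "v \<in> range (tvec (prod_atlas A1 A2) (prod_chart c c') (p, q))"
    using assms M.tangent_space_eq_range[OF prod_chart_in_atlas[OF c(1) c'(1)], of "(p, q)"] c c' by simp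
  then show ?thesis using c c' by (elim rangeE) (rule that)
qed

lemma \<pi>1_tangent: "v \<in> tangent_space (prod_atlas A1 A2) (p, q) \<Longrightarrow> \<pi>1 v \<in> tangent_space A1 p"
  by (elim prod_tangent_space_cases) (simp only: \<pi>1_tvec M1.tvec_in_tangent_space)

lemma \<pi>2_tangent: "v \<in> tangent_space (prod_atlas A1 A2) (p, q) \<Longrightarrow> \<pi>2 v \<in> tangent_space A2 q"
  by (elim prod_tangent_space_cases) (simp only: \<pi>2_tvec M2.tvec_in_tangent_space)

lemma \<iota>1_tangent:
  assumes "v \<in> tangent_space A1 p"
  shows "\<iota>1 q v \<in> tangent_space (prod_atlas A1 A2) (p, q)"
proof -
  obtain c e where c: "c \<in> A1" "p \<in> fst c" and v: "v = tvec A1 c p e" using assms by (rule M1.tangent_space_cases)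
  obtain c' where c': "c' \<in> A2" "q \<in> fst c'" by (rule M2.exists_chart)
  show ?thesis unfolding v \<iota>1_tvec[OF c(1) c'(1) c(2) c'(2)]
    using c c' by (intro M.tvec_in_tangent_space prod_chart_in_atlas) auto
qed

lemma \<iota>2_tangent:
  assumes "v \<in> tangent_space A2 q"
  shows "\<iota>2 p v \<in> tangent_space (prod_atlas A1 A2) (p, q)"
proof -
  obtain c' e where c': "c' \<in> A2" "q \<in> fst c'" and v: "v = tvec A2 c' q e" using assms by (rule M2.tangent_space_cases)
  obtain c where c: "c \<in> A1" "p \<in> fst c" by (rule M1.exists_chart)
  show ?thesis unfolding v \<iota>2_tvec[OF c(1) c'(1) c(2) c'(2)]
    using c c' by (intro M.tvec_in_tangent_space prod_chart_in_atlas) auto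
qed

lemma \<pi>1_\<iota>1: "v \<in> tangent_space A1 p \<Longrightarrow> \<pi>1 (\<iota>1 q v) = v"
  by (intro ext) (simp add: push_forward_def comp_def smooth_lift_fst M1.tangent_space_outside)

lemma \<pi>2_\<iota>2: "v \<in> tangent_space A2 q \<Longrightarrow> \<pi>2 (\<iota>2 p v) = v"
  by (intro ext) (simp add: push_forward_def comp_def smooth_lift_snd M2.tangent_space_outside)

text \<open>The second projection is constant along the slice, and derivations kill
  constants.\<close>

lemma \<pi>2_\<iota>1: "v \<in> tangent_space A1 p \<Longrightarrow> \<pi>2 (\<iota>1 q v) = (\<lambda>_. 0)"
  by (intro ext) (simp add: push_forward_def comp_def M1.tangent_vector_const)

lemma \<pi>1_\<iota>2: "v \<in> tangent_space A2 q \<Longrightarrow> \<pi>1 (\<iota>2 p v) = (\<lambda>_. 0)"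
  by (intro ext) (simp add: push_forward_def comp_def M2.tangent_vector_const)

section \<open>Components of covectors on the product\<close>

text \<open>The restriction of a covector at \<open>(p, q)\<close> to the directions of the first
  factor, that is, its pull-back along the slice inclusion at a single point. With
  \<open>cov2\<close> it realises the splitting of the cotangent space of a product.\<close>

definition cov1 :: "'a \<Rightarrow> 'b \<Rightarrow> ('a \<times> 'b) covec \<Rightarrow> 'a covec" where
  "cov1 p q a = (\<lambda>v. if v \<in> tangent_space A1 p then a (\<iota>1 q v) else 0)"

definition cov2 :: "'a \<Rightarrow> 'b \<Rightarrow> ('a \<times> 'b) covec \<Rightarrow> 'b covec" where
  "cov2 p q a = (\<lambda>v. if v \<in> tangent_space A2 q then a (\<iota>2 p v) else 0)"

lemma cov1_in_cotangent_space:
  "a \<in> cotangent_space (prod_atlas A1 A2) (p, q) \<Longrightarrow> cov1 p q a \<in> cotangent_space A1 p"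
  by (auto simp: cotangent_space_def[of A1] cov1_def M1.tangent_space_add M1.tangent_space_scale
      push_forward_add push_forward_scale M.cotangent_add M.cotangent_scale \<iota>1_tangent)

lemma cov2_in_cotangent_space:
  "a \<in> cotangent_space (prod_atlas A1 A2) (p, q) \<Longrightarrow> cov2 p q a \<in> cotangent_space A2 q"
  by (auto simp: cotangent_space_def[of A2] cov2_def M2.tangent_space_add M2.tangent_space_scale
      push_forward_add push_forward_scale M.cotangent_add M.cotangent_scale \<iota>2_tangent)

lemma cov1_add: "cov1 p q (\<lambda>v. a v + b v) = (\<lambda>v. cov1 p q a v + cov1 p q b v)"
  by (auto simp: cov1_def)

lemma cov2_add: "cov2 p q (\<lambda>v. a v + b v) = (\<lambda>v. cov2 p q a v + cov2 p q b v)"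
  by (auto simp: cov2_def)

lemma cov1_scale: "cov1 p q (\<lambda>v. r * a v) = (\<lambda>v. r * cov1 p q a v)"
  by (auto simp: cov1_def)

lemma cov2_scale: "cov2 p q (\<lambda>v. r * a v) = (\<lambda>v. r * cov2 p q a v)"
  by (auto simp: cov2_def)

lemma cov1_differential:
  assumes "F \<in> M.sf"
  shows "cov1 p q (M.d F (p, q)) = M1.d (\<lambda>p. F (p, q)) p"
  using assms \<iota>1_tangent by (intro ext) (simp add: cov1_def differential_def, simp add: push_forward_def comp_def)

lemma cov2_differential:
  assumes "F \<in> M.sf"
  shows "cov2 p q (M.d F (p, q)) = M2.d (\<lambda>q. F (p, q)) q"
  using assms \<iota>2_tangent by (intro ext) (simp add: cov2_def differential_def, simp add: push_forward_def comp_def)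

lemma horizontal_lift_in_cotangent_space:
  assumes "\<alpha> p \<in> cotangent_space A1 p"
  shows "horizontal_lift A1 A2 \<alpha> (p, q) \<in> cotangent_space (prod_atlas A1 A2) (p, q)"
  using assms
  by (auto simp: cotangent_space_def[of "prod_atlas A1 A2"] pull_back_def M.tangent_space_add M.tangent_space_scale
      push_forward_add push_forward_scale M1.cotangent_add M1.cotangent_scale \<pi>1_tangent)

lemma vertical_lift_in_cotangent_space:
  assumes "\<beta> q \<in> cotangent_space A2 q"
  shows "vertical_lift A1 A2 \<beta> (p, q) \<in> cotangent_space (prod_atlas A1 A2) (p, q)"
  using assms
  by (auto simp: cotangent_space_def[of "prod_atlas A1 A2"] pull_back_def M.tangent_space_add M.tangent_space_scale
      push_forward_add push_forward_scale M2.cotangent_add M2.cotangent_scale \<pi>2_tangent)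

lemma cov1_horizontal_lift:
  "\<alpha> p \<in> cotangent_space A1 p \<Longrightarrow> cov1 p q (horizontal_lift A1 A2 \<alpha> (p, q)) = \<alpha> p"
  by (intro ext) (simp add: cov1_def pull_back_def \<iota>1_tangent \<pi>1_\<iota>1 M1.cotangent_outside)

lemma cov2_vertical_lift:
  "\<beta> q \<in> cotangent_space A2 q \<Longrightarrow> cov2 p q (vertical_lift A1 A2 \<beta> (p, q)) = \<beta> q"
  by (intro ext) (simp add: cov2_def pull_back_def \<iota>2_tangent \<pi>2_\<iota>2 M2.cotangent_outside)

lemma cov2_horizontal_lift:
  "\<alpha> p \<in> cotangent_space A1 p \<Longrightarrow> cov2 p q (horizontal_lift A1 A2 \<alpha> (p, q)) = (\<lambda>_. 0)"
  by (intro ext) (simp add: cov2_def pull_back_def \<iota>2_tangent \<pi>1_\<iota>2 M1.cotangent_zero)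

lemma cov1_vertical_lift:
  "\<beta> q \<in> cotangent_space A2 q \<Longrightarrow> cov1 p q (vertical_lift A1 A2 \<beta> (p, q)) = (\<lambda>_. 0)"
  by (intro ext) (simp add: cov1_def pull_back_def \<iota>1_tangent \<pi>2_\<iota>1 M2.cotangent_zero)

text \<open>In a product chart a direction is \<open>(fst e, 0) + (0, snd e)\<close>, and the two
  summands see exactly the two components. The families \<alpha> and \<beta> are constrained only at
  \<open>p\<close> and \<open>q\<close>, since the lifts at \<open>(p, q)\<close> use no other
  value.\<close>

lemma covector_split:
  assumes a: "a \<in> cotangent_space (prod_atlas A1 A2) (p, q)"
    and \<alpha>: "\<alpha> p = cov1 p q a" and \<beta>: "\<beta> q = cov2 p q a"
  shows "a = (\<lambda>v. horizontal_lift A1 A2 \<alpha> (p, q) v + vertical_lift A1 A2 \<beta> (p, q) v)"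
proof -
  obtain c where c: "c \<in> A1" "p \<in> fst c" by (rule M1.exists_chart)
  obtain c' where c': "c' \<in> A2" "q \<in> fst c'" by (rule M2.exists_chart)
  note cc = c(1) c'(1) c(2) c'(2)
  have C: "prod_chart c c' \<in> prod_atlas A1 A2" "(p, q) \<in> fst (prod_chart c c')"
    using prod_chart_in_atlas c c' by auto
  have \<alpha>\<beta>: "\<alpha> p \<in> cotangent_space A1 p" "\<beta> q \<in> cotangent_space A2 q"
    unfolding \<alpha> \<beta> using cov1_in_cotangent_space[OF a] cov2_in_cotangent_space[OF a] by auto
  show ?thesis
  proof (rule M.cotangent_eqI[OF a _ C])
    show "(\<lambda>v. horizontal_lift A1 A2 \<alpha> (p, q) v + vertical_lift A1 A2 \<beta> (p, q) v)
        \<in> cotangent_space (prod_atlas A1 A2) (p, q)"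
      by (intro M.cotangent_space_add horizontal_lift_in_cotangent_space vertical_lift_in_cotangent_space \<alpha>\<beta>)
    fix e
    let ?t = "tvec (prod_atlas A1 A2) (prod_chart c c') (p, q)"
    have t: "?t e \<in> tangent_space (prod_atlas A1 A2) (p, q)" for e by (rule M.tvec_in_tangent_space[OF C])
    have "a (?t e) = a (?t (fst e, 0)) + a (?t (0, snd e))"
      using linear_add[OF M.linear_cotangent_tvec[OF a C], of "(fst e, 0)" "(0, snd e)"] by simp
    also have "a (?t (fst e, 0)) = cov1 p q a (tvec A1 c p (fst e))"
      by (simp only: \<iota>1_tvec[OF cc, symmetric] cov1_def M1.tvec_in_tangent_space[OF c] if_True)
    also have "a (?t (0, snd e)) = cov2 p q a (tvec A2 c' q (snd e))"
      by (simp only: \<iota>2_tvec[OF cc, symmetric] cov2_def M2.tvec_in_tangent_space[OF c'] if_True)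
    finally show "a (?t e) = horizontal_lift A1 A2 \<alpha> (p, q) (?t e) + vertical_lift A1 A2 \<beta> (p, q) (?t e)"
      by (simp only: pull_back_def t if_True fst_conv snd_conv \<alpha> \<beta> \<pi>1_tvec[OF cc] \<pi>2_tvec[OF cc])
  qed
qed

end

section \<open>The warped bivector field\<close>

locale warped_manifold = product_manifold A1 A2 + B1: bivector_manifold A1 P1 + B2: bivector_manifold A2 P2
  for A1 :: "('a::{t2_space,second_countable_topology}, 'e::fin_dim_inner) chart set"
    and A2 :: "('b::{t2_space,second_countable_topology}, 'f::fin_dim_inner) chart set"
    and P1 P2 +
  fixes \<mu> :: "'a \<Rightarrow> real"
  assumes smooth_\<mu>: "\<mu> \<in> smooth_functions A1"
begin

abbreviation "T \<equiv> cotangent_space (prod_atlas A1 A2)"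

text \<open>The explicit candidate for the definite description
  \<open>warped_bivector_field\<close>; the value 0 outside the cotangent spaces is the
  normalisation demanded by \<open>bivector_at\<close>.\<close>

definition warped :: "('a \<times> 'b) bivec_field" where
  "warped = (\<lambda>(p, q) a b. if a \<in> T (p, q) \<and> b \<in> T (p, q)
     then P1 p (cov1 p q a) (cov1 p q b) + \<mu> p * P2 q (cov2 p q a) (cov2 p q b) else 0)"

lemma warped_apply:
  "a \<in> T (p, q) \<Longrightarrow> b \<in> T (p, q) \<Longrightarrow>
    warped (p, q) a b = P1 p (cov1 p q a) (cov1 p q b) + \<mu> p * P2 q (cov2 p q a) (cov2 p q b)"
  by (simp add: warped_def)

lemma warped_bivector_at: "bivector_at (prod_atlas A1 A2) (p, q) (warped (p, q))"
  unfolding bivector_at_def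
proof (intro conjI ballI allI impI)
  fix a b c assume abc: "a \<in> T (p, q)" "b \<in> T (p, q)" "c \<in> T (p, q)"
  show "warped (p, q) (\<lambda>v. a v + b v) c = warped (p, q) a c + warped (p, q) b c"
    using abc by (simp add: warped_apply M.cotangent_space_add cov1_add cov2_add
        B1.bivector_add_left B2.bivector_add_left cov1_in_cotangent_space cov2_in_cotangent_space algebra_simps)
next
  fix r a b assume ab: "a \<in> T (p, q)" "b \<in> T (p, q)"
  show "warped (p, q) (\<lambda>v. r * a v) b = r * warped (p, q) a b"
    using ab by (simp add: warped_apply M.cotangent_space_scale cov1_scale cov2_scale
        B1.bivector_scale_left B2.bivector_scale_left cov1_in_cotangent_space cov2_in_cotangent_space algebra_simps)
next
  fix a b assume ab: "a \<in> T (p, q)" "b \<in> T (p, q)"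
  show "warped (p, q) b a = - warped (p, q) a b"
    using ab by (simp add: warped_apply
        B1.bivector_antisym[OF cov1_in_cotangent_space[OF ab(1)] cov1_in_cotangent_space[OF ab(2)]]
        B2.bivector_antisym[OF cov2_in_cotangent_space[OF ab(1)] cov2_in_cotangent_space[OF ab(2)]])
next
  fix a b assume "a \<notin> T (p, q) \<or> b \<notin> T (p, q)"
  then show "warped (p, q) a b = 0" by (auto simp: warped_def)
qed

text \<open>The components \<open>cov1 p q (\<alpha> (p, q))\<close> depend on both points and are
  not a one-form on a factor, so smoothness of \<open>P1\<close> does not apply directly. In
  coordinates they expand with smooth coefficients, and only brackets of coordinate functions of the
  factors remain.\<close>

lemma warped_smooth:
  assumes \<alpha>: "\<alpha> \<in> one_forms (prod_atlas A1 A2)" and \<beta>: "\<beta> \<in> one_forms (prod_atlas A1 A2)"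
  shows "(\<lambda>z. warped z (\<alpha> z) (\<beta> z)) \<in> M.sf"
proof (rule M.smooth_functionsI)
  fix z :: "'a \<times> 'b"
  obtain p\<^sub>0 q\<^sub>0 where z: "z = (p\<^sub>0, q\<^sub>0)" by fastforce
  obtain c where c: "c \<in> A1" "p\<^sub>0 \<in> fst c" by (rule M1.exists_chart)
  obtain c' where c': "c' \<in> A2" "q\<^sub>0 \<in> fst c'" by (rule M2.exists_chart)
  have C: "prod_chart c c' \<in> prod_atlas A1 A2" "(p\<^sub>0, q\<^sub>0) \<in> fst (prod_chart c c')"
    using prod_chart_in_atlas c c' by auto
  obtain N1 x where x: "open N1" "p\<^sub>0 \<in> N1" "N1 \<subseteq> fst c" "\<forall>b. x b \<in> M1.sf"
    "\<forall>p\<in>N1. \<forall>e b. tvec A1 c p e (x b) = e \<bullet> b"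
    by (rule M1.chart_coordinates[OF c])
  obtain N2 y where y: "open N2" "q\<^sub>0 \<in> N2" "N2 \<subseteq> fst c'" "\<forall>b. y b \<in> M2.sf"
    "\<forall>q\<in>N2. \<forall>e b. tvec A2 c' q e (y b) = e \<bullet> b"
    by (rule M2.chart_coordinates[OF c'])
  obtain N3 E where E: "open N3" "(p\<^sub>0, q\<^sub>0) \<in> N3" "N3 \<subseteq> fst (prod_chart c c')"
    "\<forall>e. smooth_vector_field (prod_atlas A1 A2) (E e)"
    "\<forall>z\<in>N3. \<forall>e. E e z = tvec (prod_atlas A1 A2) (prod_chart c c') z e"
    by (rule M.chart_vector_fields[OF C])
  obtain B :: "'e set" where B: "finite B" "\<forall>x. x = (\<Sum>b\<in>B. (x \<bullet> b) *\<^sub>R b)"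
    by (rule finite_orthonormal_expansion)
  obtain B' :: "'f set" where B': "finite B'" "\<forall>x. x = (\<Sum>b\<in>B'. (x \<bullet> b) *\<^sub>R b)"
    by (rule finite_orthonormal_expansion)
  define N where "N = (N1 \<times> N2) \<inter> N3"
  \<comment> \<open>On \<open>N\<close>, the fields \<open>E (b, 0)\<close> and
    \<open>E (0, b)\<close> are the images of the coordinate vectors of the factors under the slice
    inclusions, so their values give the components.\<close>
  have cov: "cov1 p q a = (\<lambda>v. \<Sum>b\<in>B. a (E (b, 0) (p, q)) * M1.d (x b) p v)"
    "cov2 p q a = (\<lambda>v. \<Sum>b\<in>B'. a (E (0, b) (p, q)) * M2.d (y b) q v)"
    if pq: "(p, q) \<in> N" and a: "a \<in> T (p, q)" for p q a
  proof -
    have pqc: "p \<in> fst c" "q \<in> fst c'" using pq x(3) y(3) by (auto simp: N_def)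
    have "cov1 p q a (tvec A1 c p b) = a (E (b, 0) (p, q))" for b
      using pq E(5) unfolding cov1_def
      by (simp add: N_def M1.tvec_in_tangent_space c(1) pqc \<iota>1_tvec[OF c(1) c'(1) pqc])
    moreover have "cov2 p q a (tvec A2 c' q b) = a (E (0, b) (p, q))" for b
      using pq E(5) unfolding cov2_def
      by (simp add: N_def M2.tvec_in_tangent_space c'(1) pqc \<iota>2_tvec[OF c(1) c'(1) pqc])
    moreover have "\<forall>e b. tvec A1 c p e (x b) = e \<bullet> b" "\<forall>e b. tvec A2 c' q e (y b) = e \<bullet> b"
      using pq x(5) y(5) by (auto simp: N_def)
    note M1.covector_coordinates[OF c(1) pqc(1) cov1_in_cotangent_space[OF a] B(2) this(1)]
      M2.covector_coordinates[OF c'(1) pqc(2) cov2_in_cotangent_space[OF a] B'(2) this(2)]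
    ultimately show "cov1 p q a = (\<lambda>v. \<Sum>b\<in>B. a (E (b, 0) (p, q)) * M1.d (x b) p v)"
      "cov2 p q a = (\<lambda>v. \<Sum>b\<in>B'. a (E (0, b) (p, q)) * M2.d (y b) q v)" by simp_all
  qed
  let ?g = "\<lambda>z. (\<Sum>b\<in>B. \<Sum>b'\<in>B. \<alpha> z (E (b, 0) z) * \<beta> z (E (b', 0) z) * B1.br (x b) (x b') (fst z)) +
    \<mu> (fst z) * (\<Sum>b\<in>B'. \<Sum>b'\<in>B'. \<alpha> z (E (0, b) z) * \<beta> z (E (0, b') z) * B2.br (y b) (y b') (snd z))"
  have sm: "(\<lambda>z. \<alpha> z (E e z)) \<in> M.sf" "(\<lambda>z. \<beta> z (E e z)) \<in> M.sf" for e
    using \<alpha> \<beta> E(4) unfolding one_forms_def by blast+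
  have "?g \<in> M.sf"
    using x(4) y(4)
    by (intro M.smooth_functions_add M.smooth_functions_mult M.smooth_functions_sum sm
        smooth_lift_fst smooth_lift_snd smooth_\<mu> B1.bracket_smooth B2.bracket_smooth) auto
  moreover have "open N" "z \<in> N" using x y E by (auto simp: N_def z intro: open_Times)
  moreover have "warped w (\<alpha> w) (\<beta> w) = ?g w" if "w \<in> N" for w
  proof -
    obtain p q where w: "w = (p, q)" by fastforce
    have T: "\<alpha> (p, q) \<in> T (p, q)" "\<beta> (p, q) \<in> T (p, q)" using \<alpha> \<beta> by (auto simp: one_forms_def)
    note cov' = cov[OF that[unfolded w] T(1)] cov[OF that[unfolded w] T(2)]
    show ?thesis
      unfolding w warped_apply[OF T] cov'
      by (simp only: B1.bivector_sum_sum[OF M1.differential_in_cotangent_space M1.differential_in_cotangent_space]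
          B2.bivector_sum_sum[OF M2.differential_in_cotangent_space M2.differential_in_cotangent_space]
          bracket_def fst_conv snd_conv)
  qed
  ultimately show "M.smooth_at (\<lambda>z. warped z (\<alpha> z) (\<beta> z)) z"
    by (rule M.smooth_at_locally_eq)
qed

lemma bivector_field_warped: "bivector_field (prod_atlas A1 A2) warped"
  unfolding bivector_field_def using warped_bivector_at warped_smooth by (simp add: split_paired_All)

sublocale W: bivector_manifold "prod_atlas A1 A2" warped
  by unfold_locales (rule bivector_field_warped)

section \<open>Characterisation of the warped field\<close>

text \<open>The predicate under the definite description in
  \<open>warped_bivector_field\<close>.\<close>

definition warped_spec :: "('a \<times> 'b) bivec_field \<Rightarrow> bool" where
  "warped_spec P \<longleftrightarrow> bivector_field (prod_atlas A1 A2) P \<and>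
     (\<forall>\<alpha>\<in>one_forms A1. \<forall>\<beta>\<in>one_forms A1. \<forall>p q.
        P (p, q) (horizontal_lift A1 A2 \<alpha> (p, q)) (horizontal_lift A1 A2 \<beta> (p, q))
          = P1 p (\<alpha> p) (\<beta> p)) \<and>
     (\<forall>\<alpha>\<in>one_forms A2. \<forall>\<beta>\<in>one_forms A2. \<forall>p q.
        P (p, q) (vertical_lift A1 A2 \<alpha> (p, q)) (vertical_lift A1 A2 \<beta> (p, q))
          = \<mu> p * P2 q (\<alpha> q) (\<beta> q)) \<and>
     (\<forall>\<alpha>\<in>one_forms A1. \<forall>\<beta>\<in>one_forms A2. \<forall>p q.
        P (p, q) (horizontal_lift A1 A2 \<alpha> (p, q)) (vertical_lift A1 A2 \<beta> (p, q)) = 0)"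

lemma warped_spec_warped: "warped_spec warped"
  unfolding warped_spec_def
proof (intro conjI ballI allI bivector_field_warped)
  fix \<alpha> \<beta> p q assume "\<alpha> \<in> one_forms A1" "\<beta> \<in> one_forms A1"
  then have "\<alpha> p \<in> cotangent_space A1 p" "\<beta> p \<in> cotangent_space A1 p" by (auto simp: one_forms_def)
  then show "warped (p, q) (horizontal_lift A1 A2 \<alpha> (p, q)) (horizontal_lift A1 A2 \<beta> (p, q)) = P1 p (\<alpha> p) (\<beta> p)"
    by (simp add: warped_apply horizontal_lift_in_cotangent_space cov1_horizontal_lift cov2_horizontal_lift
        B2.bivector_zero_left M2.cotangent_space_zero)
next
  fix \<alpha> \<beta> p q assume "\<alpha> \<in> one_forms A2" "\<beta> \<in> one_forms A2"
  then have "\<alpha> q \<in> cotangent_space A2 q" "\<beta> q \<in> cotangent_space A2 q" by (auto simp: one_forms_def)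
  then show "warped (p, q) (vertical_lift A1 A2 \<alpha> (p, q)) (vertical_lift A1 A2 \<beta> (p, q)) = \<mu> p * P2 q (\<alpha> q) (\<beta> q)"
    by (simp add: warped_apply vertical_lift_in_cotangent_space cov1_vertical_lift cov2_vertical_lift
        B1.bivector_zero_left M1.cotangent_space_zero)
next
  fix \<alpha> \<beta> p q assume "\<alpha> \<in> one_forms A1" "\<beta> \<in> one_forms A2"
  then have "\<alpha> p \<in> cotangent_space A1 p" "\<beta> q \<in> cotangent_space A2 q" by (auto simp: one_forms_def)
  then show "warped (p, q) (horizontal_lift A1 A2 \<alpha> (p, q)) (vertical_lift A1 A2 \<beta> (p, q)) = 0"
    by (simp add: warped_apply horizontal_lift_in_cotangent_space vertical_lift_in_cotangent_space
        cov1_horizontal_lift cov2_horizontal_lift cov1_vertical_lift cov2_vertical_lift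
        B1.bivector_zero_right B2.bivector_zero_left)
qed

text \<open>The specification speaks only of lifts of global one-forms. Since each component of a
  covector is the differential of a global function, every covector at a point is a sum of such
  lifts, and bilinearity fixes the value.\<close>

lemma warped_spec_apply:
  assumes P: "warped_spec P" and ab: "a \<in> T (p, q)" "b \<in> T (p, q)"
  shows "P (p, q) a b = P1 p (cov1 p q a) (cov1 p q b) + \<mu> p * P2 q (cov2 p q a) (cov2 p q b)"
proof -
  interpret Q: bivector_manifold "prod_atlas A1 A2" P
    using P by unfold_locales (simp add: warped_spec_def)
  let ?h = "\<lambda>f. horizontal_lift A1 A2 (M1.d f) (p, q)" and ?v = "\<lambda>f. vertical_lift A1 A2 (M2.d f) (p, q)"
  have T: "?h f \<in> T (p, q)" "?v g \<in> T (p, q)" for f g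
    by (intro horizontal_lift_in_cotangent_space vertical_lift_in_cotangent_space
        M1.differential_in_cotangent_space M2.differential_in_cotangent_space)+
  have split: "\<exists>f\<in>M1.sf. \<exists>g\<in>M2.sf. M1.d f p = cov1 p q a \<and> M2.d g q = cov2 p q a \<and>
      a = (\<lambda>v. ?h f v + ?v g v)" if a: "a \<in> T (p, q)" for a
  proof -
    obtain f where f: "f \<in> M1.sf" "M1.d f p = cov1 p q a"
      by (rule M1.covector_is_differential[OF cov1_in_cotangent_space[OF a]])
    obtain g where g: "g \<in> M2.sf" "M2.d g q = cov2 p q a"
      by (rule M2.covector_is_differential[OF cov2_in_cotangent_space[OF a]])
    show ?thesis using f g covector_split[of a p q "M1.d f" "M2.d g", OF a f(2) g(2)] by blast
  qed
  obtain f g where fg: "f \<in> M1.sf" "g \<in> M2.sf" "M1.d f p = cov1 p q a" "M2.d g q = cov2 p q a"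
    "a = (\<lambda>v. ?h f v + ?v g v)" using split[OF ab(1)] by blast
  obtain f' g' where fg': "f' \<in> M1.sf" "g' \<in> M2.sf" "M1.d f' p = cov1 p q b" "M2.d g' q = cov2 p q b"
    "b = (\<lambda>v. ?h f' v + ?v g' v)" using split[OF ab(2)] by blast
  have "P (p, q) a b = P (p, q) (?h f) (?h f') + P (p, q) (?h f) (?v g') +
      (P (p, q) (?v g) (?h f') + P (p, q) (?v g) (?v g'))"
    unfolding fg(5) fg'(5)
    by (simp add: Q.bivector_add_left Q.bivector_add_right T M.cotangent_space_add)
  \<comment> \<open>The specification prescribes the mixed value in horizontal-vertical order only;
    antisymmetry supplies the other one.\<close>
  also have "P (p, q) (?v g) (?h f') = - P (p, q) (?h f') (?v g)" by (intro Q.bivector_antisym T)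
  finally show ?thesis
    using P fg(1-4) fg'(1-4) unfolding warped_spec_def
    by (simp add: M1.differential_in_one_forms M2.differential_in_one_forms)
qed

lemma warped_bivector_field_eq: "warped_bivector_field A1 P1 \<mu> A2 P2 = warped"
  unfolding warped_bivector_field_def warped_spec_def[symmetric]
proof (rule the_equality[where P = warped_spec, OF warped_spec_warped])
  fix P assume P: "warped_spec P"
  interpret Q: bivector_manifold "prod_atlas A1 A2" P
    using P by unfold_locales (simp add: warped_spec_def)
  show "P = warped"
  proof (intro ext)
    fix z :: "'a \<times> 'b" and a b
    obtain p q where z: "z = (p, q)" by fastforce
    show "P z a b = warped z a b"
    proof (cases "a \<in> T z \<and> b \<in> T z")
      case True
      then show ?thesis using warped_spec_apply[OF P] by (simp add: z warped_apply)
    qed (auto simp: Q.bivector_outside W.bivector_outside)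
  qed
qed

section \<open>Brackets and Jacobiators of lifts\<close>

lemma bracket_warped:
  assumes "F \<in> M.sf" "G \<in> M.sf"
  shows "W.br F G (p, q) = B1.br (\<lambda>p. F (p, q)) (\<lambda>p. G (p, q)) p + \<mu> p * B2.br (\<lambda>q. F (p, q)) (\<lambda>q. G (p, q)) q"
  by (simp add: bracket_def warped_apply M.differential_in_cotangent_space cov1_differential cov2_differential assms)

lemma bracket_warped_fst_fst:
  "f \<in> M1.sf \<Longrightarrow> g \<in> M1.sf \<Longrightarrow> W.br (\<lambda>z. f (fst z)) (\<lambda>z. g (fst z)) = (\<lambda>z. B1.br f g (fst z))"
  by (auto simp: bracket_warped smooth_lift_fst B2.bracket_const_right)

lemma bracket_warped_snd_snd:
  "f \<in> M2.sf \<Longrightarrow> g \<in> M2.sf \<Longrightarrow>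
    W.br (\<lambda>z. f (snd z)) (\<lambda>z. g (snd z)) = (\<lambda>z. \<mu> (fst z) * B2.br f g (snd z))"
  by (auto simp: bracket_warped smooth_lift_snd B1.bracket_const_right)

lemma bracket_warped_fst_snd:
  "f \<in> M1.sf \<Longrightarrow> g \<in> M2.sf \<Longrightarrow> W.br (\<lambda>z. f (fst z)) (\<lambda>z. g (snd z)) = (\<lambda>_. 0)"
  by (auto simp: bracket_warped smooth_lift_fst smooth_lift_snd B1.bracket_const_right B2.bracket_const_left)

lemma bracket_warped_snd_fst:
  "f \<in> M2.sf \<Longrightarrow> g \<in> M1.sf \<Longrightarrow> W.br (\<lambda>z. f (snd z)) (\<lambda>z. g (fst z)) = (\<lambda>_. 0)"
  by (auto simp: bracket_warped smooth_lift_fst smooth_lift_snd B1.bracket_const_left B2.bracket_const_right)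

lemmas bracket_warped_lifts =
  bracket_warped_fst_fst bracket_warped_snd_snd bracket_warped_fst_snd bracket_warped_snd_fst

lemma jacobiator_fst_fst_fst:
  "f \<in> M1.sf \<Longrightarrow> g \<in> M1.sf \<Longrightarrow> h \<in> M1.sf \<Longrightarrow>
    W.jacobiator (\<lambda>z. f (fst z)) (\<lambda>z. g (fst z)) (\<lambda>z. h (fst z)) (p, q) = B1.jacobiator f g h p"
  by (simp add: W.jacobiator_def B1.jacobiator_def bracket_warped_lifts B1.bracket_smooth)

text \<open>Each inner bracket is 0 or again a lift from the first factor, which commutes with
  \<open>h\<close>. The factor \<mu> arises only from brackets of two lifts from the second
  factor.\<close>

lemma jacobiator_fst_fst_snd:
  "f \<in> M1.sf \<Longrightarrow> g \<in> M1.sf \<Longrightarrow> h \<in> M2.sf \<Longrightarrow>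
    W.jacobiator (\<lambda>z. f (fst z)) (\<lambda>z. g (fst z)) (\<lambda>z. h (snd z)) z = 0"
  by (simp add: W.jacobiator_def bracket_warped_lifts B1.bracket_smooth W.bracket_const_right)

text \<open>The two terms with a mixed inner bracket vanish. In the remaining one the Leibniz rule
  lets \<open>f\<close> differentiate the factor \<mu> of the inner bracket; among the Jacobiators
  of lifts this is the only one that sees the derivative of \<mu>.\<close>

lemma jacobiator_fst_snd_snd:
  "f \<in> M1.sf \<Longrightarrow> g \<in> M2.sf \<Longrightarrow> h \<in> M2.sf \<Longrightarrow>
    W.jacobiator (\<lambda>z. f (fst z)) (\<lambda>z. g (snd z)) (\<lambda>z. h (snd z)) (p, q) = B1.br f \<mu> p * B2.br g h q"
  by (simp add: W.jacobiator_def bracket_warped_lifts W.bracket_const_right W.bracket_mult_right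
      smooth_lift_fst smooth_lift_snd smooth_\<mu> B2.bracket_smooth)

text \<open>Each of the two nested brackets contributes one factor \<mu>; the term in which \<mu>
  would be differentiated is a mixed bracket and vanishes.\<close>

lemma jacobiator_snd_snd_snd:
  "f \<in> M2.sf \<Longrightarrow> g \<in> M2.sf \<Longrightarrow> h \<in> M2.sf \<Longrightarrow>
    W.jacobiator (\<lambda>z. f (snd z)) (\<lambda>z. g (snd z)) (\<lambda>z. h (snd z)) (p, q) = (\<mu> p)\<^sup>2 * B2.jacobiator f g h q"
  by (simp add: W.jacobiator_def B2.jacobiator_def bracket_warped_lifts W.bracket_mult_right
      smooth_lift_fst smooth_lift_snd smooth_\<mu> B2.bracket_smooth power2_eq_square algebra_simps)

section \<open>Reduction of the Jacobi identity to lifts\<close>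

text \<open>Along each factor one of the two summands is constant and the other is the slice of
  \<open>F\<close>, so the components of the differentials agree, although the values at
  \<open>(p, q)\<close> differ by \<open>F (p, q)\<close>.\<close>

lemma differential_lift_sum:
  assumes F: "F \<in> M.sf"
  shows "M.d F (p, q) = M.d (\<lambda>z. F (fst z, q) + F (p, snd z)) (p, q)"
proof -
  let ?F1 = "\<lambda>z. F (fst z, q)" and ?F2 = "\<lambda>z. F (p, snd z)"
  have sm: "?F1 \<in> M.sf" "?F2 \<in> M.sf"
    using smooth_lift_fst[OF smooth_slice_fst[OF F]] smooth_lift_snd[OF smooth_slice_snd[OF F]] by auto
  have dT: "M.d G (p, q) \<in> T (p, q)" for G by (rule M.differential_in_cotangent_space)
  have c: "cov1 p q (M.d (\<lambda>z. ?F1 z + ?F2 z) (p, q)) = cov1 p q (M.d F (p, q))"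
    "cov2 p q (M.d (\<lambda>z. ?F1 z + ?F2 z) (p, q)) = cov2 p q (M.d F (p, q))"
    by (simp_all add: M.differential_add sm cov1_add cov2_add cov1_differential cov2_differential F
        M1.differential_const M2.differential_const)
  let ?\<alpha> = "\<lambda>_. cov1 p q (M.d F (p, q))" and ?\<beta> = "\<lambda>_. cov2 p q (M.d F (p, q))"
  show ?thesis
    by (rule trans[OF covector_split[of _ _ _ ?\<alpha> ?\<beta>, OF dT] covector_split[of _ _ _ ?\<alpha> ?\<beta>, OF dT, symmetric]])
       (simp_all only: c)
qed

definition lifts :: "('a \<times> 'b \<Rightarrow> real) set" where
  "lifts = {\<lambda>z. f (fst z) | f. f \<in> M1.sf} \<union> {\<lambda>z. g (snd z) | g. g \<in> M2.sf}"

lemma lifts_fst: "f \<in> M1.sf \<Longrightarrow> (\<lambda>z. f (fst z)) \<in> lifts"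
  unfolding lifts_def by (intro UnI1 CollectI exI[of _ f] conjI refl)

lemma lifts_snd: "g \<in> M2.sf \<Longrightarrow> (\<lambda>z. g (snd z)) \<in> lifts"
  unfolding lifts_def by (intro UnI2 CollectI exI[of _ g] conjI refl)

lemma lifts_smooth: "F \<in> lifts \<Longrightarrow> F \<in> M.sf"
  using smooth_lift_fst smooth_lift_snd by (auto simp: lifts_def)

text \<open>Replaces one argument by lifts while the other two stay arbitrary smooth functions, so
  that with cyclicity it can be applied to each argument in turn.\<close>

lemma jacobiator_reduce:
  assumes "\<And>L. L \<in> lifts \<Longrightarrow> W.jacobiator L G H z = 0" "F \<in> M.sf" "G \<in> M.sf" "H \<in> M.sf"
  shows "W.jacobiator F G H z = 0"
proof -
  obtain p q where z: "z = (p, q)" by fastforce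
  let ?F1 = "\<lambda>z. F (fst z, q)" and ?F2 = "\<lambda>z. F (p, snd z)"
  have L: "?F1 \<in> lifts" "?F2 \<in> lifts"
    by (rule lifts_fst[OF smooth_slice_fst[OF assms(2)]] lifts_snd[OF smooth_slice_snd[OF assms(2)]])+
  note sm = L[THEN lifts_smooth]
  have "W.jacobiator F G H z = W.jacobiator (\<lambda>z. ?F1 z + ?F2 z) G H z"
    unfolding z by (intro W.jacobiator_cong differential_lift_sum M.smooth_functions_add sm assms)
  also have "\<dots> = 0"
    using W.jacobiator_add[OF sm assms(3,4)] assms(1)[OF L(1)] assms(1)[OF L(2)] by simp
  finally show ?thesis .
qed

lemma poisson_warped_iff:
  assumes P1: "poisson_tensor A1 P1" and P2: "poisson_tensor A2 P2" "P2 \<noteq> (\<lambda>q a b. 0)"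
  shows "poisson_tensor (prod_atlas A1 A2) warped \<longleftrightarrow> casimir A1 P1 \<mu>"
proof
  assume W: "poisson_tensor (prod_atlas A1 A2) warped"
  \<comment> \<open>One point where \<open>P2\<close> is nonzero suffices: with \<open>g\<close> and
    \<open>h\<close> realising the covectors there, \<open>B2.br g h q\<close> is a nonzero factor
    that can be cancelled for every \<open>f\<close> and every \<open>p\<close>.\<close>
  obtain q a b where q: "P2 q a b \<noteq> 0" using P2(2) by (meson ext)
  then have ab: "a \<in> cotangent_space A2 q" "b \<in> cotangent_space A2 q"
    using B2.bivector_outside by blast+
  obtain g where g: "g \<in> M2.sf" "M2.d g q = a" by (rule M2.covector_is_differential[OF ab(1)])
  obtain h where h: "h \<in> M2.sf" "M2.d h q = b" by (rule M2.covector_is_differential[OF ab(2)])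
  have "B1.br \<mu> f p = 0" if f: "f \<in> M1.sf" for f p
  proof -
    have "W.jacobiator (\<lambda>z. f (fst z)) (\<lambda>z. g (snd z)) (\<lambda>z. h (snd z)) (p, q) = 0"
      using W f g(1) h(1) by (simp add: W.poisson_tensor_iff smooth_lift_fst smooth_lift_snd)
    then have "B1.br f \<mu> p * B2.br g h q = 0" using jacobiator_fst_snd_snd[OF f g(1) h(1)] by simp
    moreover have "B2.br g h q \<noteq> 0" using q g h by (simp add: bracket_def)
    ultimately show ?thesis by (simp add: B1.bracket_antisym[of \<mu> f])
  qed
  then show "casimir A1 P1 \<mu>" using smooth_\<mu> by (simp add: B1.casimir_iff)
next
  assume "casimir A1 P1 \<mu>"
  then have C: "B1.br f \<mu> p = 0" if "f \<in> M1.sf" for f p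
    using that by (simp add: B1.casimir_iff B1.bracket_antisym[of f \<mu>])
  have J1: "B1.jacobiator f g h p = 0" if "f \<in> M1.sf" "g \<in> M1.sf" "h \<in> M1.sf" for f g h p
    using P1 that by (simp add: B1.poisson_tensor_iff)
  have J2: "B2.jacobiator f g h q = 0" if "f \<in> M2.sf" "g \<in> M2.sf" "h \<in> M2.sf" for f g h q
    using P2(1) that by (simp add: B2.poisson_tensor_iff)
  have J: "W.jacobiator F G H z = 0" if L: "F \<in> lifts" "G \<in> lifts" "H \<in> lifts" for F G H z
  proof -
    obtain p q where z: "z = (p, q)" by fastforce
    \<comment> \<open>The Jacobiator is computed above for one position of the exceptional argument;
      the three rotations cover every position, here and in \<open>J22\<close>.\<close>
    have J12: "W.jacobiator (\<lambda>z. f (fst z)) (\<lambda>z. g (fst z)) (\<lambda>z. h (snd z)) (p, q) = 0"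
      "W.jacobiator (\<lambda>z. g (fst z)) (\<lambda>z. h (snd z)) (\<lambda>z. f (fst z)) (p, q) = 0"
      "W.jacobiator (\<lambda>z. h (snd z)) (\<lambda>z. f (fst z)) (\<lambda>z. g (fst z)) (p, q) = 0"
      if "f \<in> M1.sf" "g \<in> M1.sf" "h \<in> M2.sf" for f g h
      using jacobiator_fst_fst_snd[OF that, of "(p, q)"]
        W.jacobiator_cyclic[of "\<lambda>z. f (fst z)" "\<lambda>z. g (fst z)" "\<lambda>z. h (snd z)" "(p, q)"]
        W.jacobiator_cyclic[of "\<lambda>z. h (snd z)" "\<lambda>z. f (fst z)" "\<lambda>z. g (fst z)" "(p, q)"]
      by simp_all
    have J22: "W.jacobiator (\<lambda>z. f (fst z)) (\<lambda>z. g (snd z)) (\<lambda>z. h (snd z)) (p, q) = 0"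
      "W.jacobiator (\<lambda>z. g (snd z)) (\<lambda>z. h (snd z)) (\<lambda>z. f (fst z)) (p, q) = 0"
      "W.jacobiator (\<lambda>z. h (snd z)) (\<lambda>z. f (fst z)) (\<lambda>z. g (snd z)) (p, q) = 0"
      if "f \<in> M1.sf" "g \<in> M2.sf" "h \<in> M2.sf" for f g h
      using jacobiator_fst_snd_snd[OF that, of p q] C[OF that(1), of p]
        W.jacobiator_cyclic[of "\<lambda>z. f (fst z)" "\<lambda>z. g (snd z)" "\<lambda>z. h (snd z)" "(p, q)"]
        W.jacobiator_cyclic[of "\<lambda>z. h (snd z)" "\<lambda>z. f (fst z)" "\<lambda>z. g (snd z)" "(p, q)"]
      by simp_all
    show ?thesis
      using L unfolding lifts_def z
      by (auto simp: jacobiator_fst_fst_fst jacobiator_snd_snd_snd J1 J2 J12 J22)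
  qed
  \<comment> \<open>Three nested reductions, each followed by a rotation that brings the next
    argument to the front, until all three arguments are lifts and \<open>J\<close> applies.\<close>
  have "W.jacobiator F G H z = 0" if "F \<in> M.sf" "G \<in> M.sf" "H \<in> M.sf" for F G H z
  proof (rule jacobiator_reduce[OF _ that])
    fix F assume F: "F \<in> lifts"
    have "W.jacobiator G H F z = 0"
    proof (rule jacobiator_reduce[OF _ that(2,3) lifts_smooth[OF F]])
      fix G assume G: "G \<in> lifts"
      have "W.jacobiator H F G z = 0"
        by (rule jacobiator_reduce[OF J that(3) lifts_smooth[OF F] lifts_smooth[OF G]]) (use F G in auto)
      then show "W.jacobiator G H F z = 0" using W.jacobiator_cyclic[of G H F z] by simp
    qed
    then show "W.jacobiator F G H z = 0" using W.jacobiator_cyclic[of F G H z] by simp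
  qed
  then show "poisson_tensor (prod_atlas A1 A2) warped" by (simp add: W.poisson_tensor_iff)
qed

end

theorem theorem4p2:
  fixes A1 :: "('a::{t2_space,second_countable_topology}, 'e::fin_dim_inner) chart set"
    and A2 :: "('b::{t2_space,second_countable_topology}, 'f::fin_dim_inner) chart set"
    and P1 :: "'a bivec_field" and P2 :: "'b bivec_field" and \<mu> :: "'a \<Rightarrow> real"
  assumes "poisson_manifold A1 P1" and "poisson_manifold A2 P2"
    and "P2 \<noteq> (\<lambda>q a b. 0)"
    and "\<mu> \<in> smooth_functions A1"
  shows "poisson_manifold (prod_atlas A1 A2) (warped_bivector_field A1 P1 \<mu> A2 P2)
    \<longleftrightarrow> casimir A1 P1 \<mu>"
proof -
  have P: "poisson_tensor A1 P1" "poisson_tensor A2 P2"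
    using assms(1,2) by (auto simp: poisson_manifold_def)
  interpret warped_manifold A1 A2 P1 P2 \<mu>
    using assms by unfold_locales (auto simp: poisson_manifold_def poisson_tensor_def)
  show ?thesis
    using poisson_warped_iff[OF P assms(3)] smooth_manifold_prod
    by (simp add: poisson_manifold_def warped_bivector_field_eq)
qed

end
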